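(* Let $n,m,p\ge 1$, let $A\in\mathbb{R}^{n\times n}$, $B\in\mathbb{R}^{n\times m}$, $C\in\mathbb{R}^{p\times n}$, let $h>0$, $\alpha\ge 0$ and $\varepsilon_1,\varepsilon_2,\varepsilon_3,\varepsilon_4\in\mathbb{R}$. Assume that there exist matrices $P\in\mathbb{S}^{2n}$, $R,S\in\mathbb{S}^n_+$, an invertible matrix $Z\in\mathbb{R}^{n\times n}$, a matrix $\bar L\in\mathbb{R}^{n\times p}$ and a real number $\beta_1>0$ such that $$P+\frac{e^{-2\alpha h}}{h}\,\mathrm{diag}(0_n,S)+\frac{4\alpha^2h}{e^{2\alpha h}-2h\alpha-1}\begin{bmatrix} h^2R & -hR \\ -hR & R \end{bmatrix}-\beta_1\,\mathrm{diag}(I_n,0_n)\succ 0$$ and $$\Phi(\alpha,h)+\mathrm{He}\left(N^{\top}ZF_\varepsilon+\begin{bmatrix} 0_n & 0_n & 0_n & -\bar LC \end{bmatrix}^{\top}F_\varepsilon\right)\prec 0,$$ where $$N=\begin{bmatrix} A & 0_n & -I_n & 0_n \end{bmatrix},\quad F_\varepsilon=\begin{bmatrix} \varepsilon_1I_n & \varepsilon_2I_n & \varepsilon_3I_n & \varepsilon_4I_n \end{bmatrix},$$ and $\Phi(\alpha,h)$ is the matrix (depending on $P,R,S$) defined in the context. Then, with the gain $L=Z^{-\top}\bar L$, the error system $$\dot\epsilon(t)=A\epsilon(t)-\frac1hLC\int_{t-h}^{t}\epsilon(s)\,ds\quad(t\ge0)$$ is $\alpha$-stable. That is, if $x$ satisfies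 $\dot x(t)=Ax(t)+Bu(t)$ with output $y(t)=\frac1hC\int_{t-h}^tx(s)\,ds$, and $\hat x$ satisfies the observer equation $$\dot{\hat x}(t)=A\hat x(t)+Bu(t)+L\left(y(t)-\frac1hC\int_{t-h}^{t}\hat x(s)\,ds\right)\quad (t\ge 0),$$ then $\hat x$ converges exponentially to $x$, in the sense that the error $\epsilon=x-\hat x$ satisfies the exponential estimate defining $\alpha$-stability.
   Context: $\mathbb{S}^m$ is the set of real symmetric $m\times m$ matrices; $\mathbb{S}^m_+$ is the set of symmetric positive definite ones; $M\succ0$ (resp. $M\prec 0$) means $M$ is symmetric positive (resp. negative) definite. $I_n$ is the $n\times n$ identity, $0_n$ (resp. $0_{2n}$) the zero matrix of size $n\times n$ (resp. $2n\times 2n$). $\mathrm{He}(M)=M+M^{\top}$, $Z^{-\top}=(Z^{-1})^{\top}$, and $\mathrm{diag}(\cdot)$ denotes the block-diagonal matrix. $\|\cdot\|$ is the Euclidean norm on $\mathbb{R}^n$. Given $P\in\mathbb{S}^{2n}$, $R,S\in\mathbb{S}^n_+$, $h>0$, $\alpha\ge0$: $$\Phi(\alpha,h)=\mathrm{He}\left(F_1^{\top}P(F_0+\alpha F_1)\right)+\bar S+h^2F_3^{\top}RF_3-e^{-2\alpha h}F_2^{\top}\tilde RF_2,$$ $$F_0=\begin{bmatrix} 0_n & 0_n & I_n & 0_n \\ I_n & -I_n & 0_n & 0_n \end{bmatrix},\quad F_1=\begin{bmatrix} I_n & 0_n & 0_n & 0_n \\ 0_n & 0_n & 0_n & hI_n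 \end{bmatrix},\quad F_2=\begin{bmatrix} I_n & -I_n & 0_n & 0_n \\ I_n & I_n & 0_n & -2I_n \end{bmatrix},$$ $$F_3=\begin{bmatrix} 0_n & 0_n & I_n & 0_n \end{bmatrix},\quad \tilde R=\mathrm{diag}(R,3R),\quad \bar S=\mathrm{diag}(S,-e^{-2\alpha h}S,0_{2n}).$$ For a differentiable function $\phi:[-h,0]\to\mathbb{R}^n$: $\|\phi\|_h=\sup_{\theta\in[-h,0]}\|\phi(\theta)\|$ and $\|\phi\|_W=\max\{\|\phi\|_h,\|\dot\phi\|_h\}$. A time-delay system with state $\epsilon$ is called $\alpha$-stable if there exists $\gamma\ge1$ such that every solution $\epsilon$ with a differentiable initial condition $\phi$ on $[-h,0]$ (i.e. $\epsilon(t)=\phi(t)$ for $t\in[-h,0]$) satisfies $\|\epsilon(t)\|\le\gamma e^{-\alpha t}\|\phi\|_W$ for all $t>0$. For $\alpha=0$, the coefficient $\frac{4\alpha^2h}{e^{2\alpha h}-2h\alpha-1}$ is understood as its limit as $\alpha\to0$, namely $2/h$. *)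

theory Defs
  imports "HOL-Analysis.Analysis"
begin

text \<open>Block matrices are indexed by sum types: a \<open>2n \<times> 2n\<close> matrix has index type
  \<^typ>\<open>'n + 'n\<close>, and the four block columns of a \<open>4n\<close>-column matrix are
  grouped as \<^typ>\<open>('n + 'n) + ('n + 'n)\<close>.\<close>

definition hcat :: "real^'a^'r \<Rightarrow> real^'b^'r \<Rightarrow> real^('a + 'b)^'r" where
  "hcat M N = (\<chi> i j. case j of Inl k \<Rightarrow> M $ i $ k | Inr k \<Rightarrow> N $ i $ k)"

definition vcat :: "real^'c^'a \<Rightarrow> real^'c^'b \<Rightarrow> real^'c^('a + 'b)" where
  "vcat M N = (\<chi> i. case i of Inl k \<Rightarrow> M $ k | Inr k \<Rightarrow> N $ k)"

definition block2 ::
  "real^'a^'r \<Rightarrow> real^'b^'r \<Rightarrow> real^'a^'s \<Rightarrow> real^'b^'s \<Rightarrow> real^('a + 'b)^('r + 's)" where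
  "block2 M11 M12 M21 M22 = vcat (hcat M11 M12) (hcat M21 M22)"

definition bdiag :: "real^'a^'a \<Rightarrow> real^'b^'b \<Rightarrow> real^('a + 'b)^('a + 'b)" where
  "bdiag M N = block2 M 0 0 N"

definition row4 ::
  "real^'n^'r \<Rightarrow> real^'n^'r \<Rightarrow> real^'n^'r \<Rightarrow> real^'n^'r \<Rightarrow> real^(('n + 'n) + ('n + 'n))^'r" where
  "row4 M1 M2 M3 M4 = hcat (hcat M1 M2) (hcat M3 M4)"

definition He :: "real^'k^'k \<Rightarrow> real^'k^'k" where
  "He M = M + transpose M"

definition symmetric_mat :: "real^'k^'k \<Rightarrow> bool" where
  "symmetric_mat M \<longleftrightarrow> transpose M = M"

definition pos_def :: "real^'k^'k \<Rightarrow> bool" where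
  "pos_def M \<longleftrightarrow> symmetric_mat M \<and> (\<forall>v. v \<noteq> 0 \<longrightarrow> v \<bullet> (M *v v) > 0)"

definition neg_def :: "real^'k^'k \<Rightarrow> bool" where
  "neg_def M \<longleftrightarrow> symmetric_mat M \<and> (\<forall>v. v \<noteq> 0 \<longrightarrow> v \<bullet> (M *v v) < 0)"

definition F0 :: "real^(('n::finite + 'n) + ('n + 'n))^('n + 'n)" where
  "F0 = vcat (row4 0 0 (mat 1) 0) (row4 (mat 1) (- mat 1) 0 0)"

definition F1 :: "real \<Rightarrow> real^(('n::finite + 'n) + ('n + 'n))^('n + 'n)" where
  "F1 h = vcat (row4 (mat 1) 0 0 0) (row4 0 0 0 (h *\<^sub>R mat 1))"

definition F2 :: "real^(('n::finite + 'n) + ('n + 'n))^('n + 'n)" where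
  "F2 = vcat (row4 (mat 1) (- mat 1) 0 0) (row4 (mat 1) (mat 1) 0 (- (2 *\<^sub>R mat 1)))"

definition F3 :: "real^(('n::finite + 'n) + ('n + 'n))^'n" where
  "F3 = row4 0 0 (mat 1) 0"

definition R_tilde :: "real^'n^'n \<Rightarrow> real^('n + 'n)^('n + 'n)" where
  "R_tilde R = bdiag R (3 *\<^sub>R R)"

definition S_bar :: "real^'n^'n \<Rightarrow> real \<Rightarrow> real \<Rightarrow>
    real^(('n + 'n) + ('n + 'n))^(('n + 'n) + ('n + 'n))" where
  "S_bar S \<alpha> h = bdiag (bdiag S (- (exp (- 2 * \<alpha> * h) *\<^sub>R S))) 0"

definition Phi :: "real^('n::finite + 'n)^('n + 'n) \<Rightarrow> real^'n^'n \<Rightarrow> real^'n^'n \<Rightarrow> real \<Rightarrow> real \<Rightarrow>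
    real^(('n + 'n) + ('n + 'n))^(('n + 'n) + ('n + 'n))" where
  "Phi P R S \<alpha> h =
     He (transpose (F1 h) ** P ** (F0 + \<alpha> *\<^sub>R F1 h))
     + S_bar S \<alpha> h
     + h\<^sup>2 *\<^sub>R (transpose F3 ** R ** F3)
     - exp (- 2 * \<alpha> * h) *\<^sub>R (transpose F2 ** R_tilde R ** F2)"

text \<open>The value at \<open>\<alpha> = 0\<close> is the limit of the general expression as \<open>\<alpha> \<rightarrow> 0\<close>.\<close>

definition R_coeff :: "real \<Rightarrow> real \<Rightarrow> real" where
  "R_coeff \<alpha> h =
     (if \<alpha> = 0 then 2 / h else 4 * \<alpha>\<^sup>2 * h / (exp (2 * \<alpha> * h) - 2 * h * \<alpha> - 1))"

definition N_mat :: "real^'n^'n \<Rightarrow> real^(('n + 'n) + ('n + 'n))^'n" where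
  "N_mat A = row4 A 0 (- mat 1) 0"

definition F_eps :: "real \<Rightarrow> real \<Rightarrow> real \<Rightarrow> real \<Rightarrow> real^(('n::finite + 'n) + ('n + 'n))^'n" where
  "F_eps e1 e2 e3 e4 = row4 (e1 *\<^sub>R mat 1) (e2 *\<^sub>R mat 1) (e3 *\<^sub>R mat 1) (e4 *\<^sub>R mat 1)"

text \<open>The suprema are extended reals: the derivative of a differentiable function need not
  be bounded on \<open>[-h, 0]\<close>.\<close>

definition norm_h :: "real \<Rightarrow> (real \<Rightarrow> real^'n) \<Rightarrow> ereal" where
  "norm_h h \<phi> = (SUP \<theta>\<in>{-h..0}. ereal (norm (\<phi> \<theta>)))"

definition norm_W :: "real \<Rightarrow> (real \<Rightarrow> real^'n) \<Rightarrow> ereal" where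
  "norm_W h \<phi> =
     max (norm_h h \<phi>) (norm_h h (\<lambda>\<theta>. vector_derivative \<phi> (at \<theta> within {-h..0})))"

definition exp_estimate ::
  "real \<Rightarrow> real \<Rightarrow> real \<Rightarrow> (real \<Rightarrow> real^'n) \<Rightarrow> (real \<Rightarrow> real^'n) \<Rightarrow> bool" where
  "exp_estimate \<alpha> h \<gamma> \<phi> e \<longleftrightarrow>
     (\<forall>t>0. ereal (norm (e t)) \<le> ereal (\<gamma> * exp (- \<alpha> * t)) * norm_W h \<phi>)"

text \<open>A time-delay system is given by the predicate \<open>sol\<close> singling out its solutions, which
  are functions on \<open>[-h, \<infinity>)\<close>; values at arguments below \<open>-h\<close> play no role.\<close>

definition alpha_stable ::
  "real \<Rightarrow> real \<Rightarrow> ((real \<Rightarrow> real^'n) \<Rightarrow> bool) \<Rightarrow> bool" where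
  "alpha_stable \<alpha> h sol \<longleftrightarrow>
     (\<exists>\<gamma>\<ge>1. \<forall>\<phi> e. \<phi> differentiable_on {-h..0} \<longrightarrow> (\<forall>t\<in>{-h..0}. e t = \<phi> t) \<longrightarrow> sol e
        \<longrightarrow> exp_estimate \<alpha> h \<gamma> \<phi> e)"

text \<open>All differential equations hold for \<open>t \<ge> 0\<close>, with the right derivative at \<open>t = 0\<close>.\<close>

definition error_system ::
  "real^'n^'n \<Rightarrow> real^'n^'p \<Rightarrow> real^'p^'n \<Rightarrow> real \<Rightarrow> (real \<Rightarrow> real^'n) \<Rightarrow> bool" where
  "error_system A C L h e \<longleftrightarrow>
     (\<forall>t\<ge>0. (e has_vector_derivative
        (A *v e t - (1 / h) *\<^sub>R ((L ** C) *v integral {t - h..t} e))) (at t within {0..}))"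

definition plant ::
  "real^'n^'n \<Rightarrow> real^'m^'n \<Rightarrow> (real \<Rightarrow> real^'m) \<Rightarrow> (real \<Rightarrow> real^'n) \<Rightarrow> bool" where
  "plant A B u x \<longleftrightarrow>
     (\<forall>t\<ge>0. (x has_vector_derivative (A *v x t + B *v u t)) (at t within {0..}))"

definition averaged_output ::
  "real^'n^'p \<Rightarrow> real \<Rightarrow> (real \<Rightarrow> real^'n) \<Rightarrow> (real \<Rightarrow> real^'p) \<Rightarrow> bool" where
  "averaged_output C h x y \<longleftrightarrow> (\<forall>t\<ge>0. y t = (1 / h) *\<^sub>R (C *v integral {t - h..t} x))"

definition observer ::
  "real^'n^'n \<Rightarrow> real^'m^'n \<Rightarrow> real^'n^'p \<Rightarrow> real^'p^'n \<Rightarrow> real \<Rightarrow>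
   (real \<Rightarrow> real^'m) \<Rightarrow> (real \<Rightarrow> real^'p) \<Rightarrow> (real \<Rightarrow> real^'n) \<Rightarrow> bool" where
  "observer A B C L h u y xh \<longleftrightarrow>
     (\<forall>t\<ge>0. (xh has_vector_derivative
        (A *v xh t + B *v u t
         + L *v (y t - (1 / h) *\<^sub>R (C *v integral {t - h..t} xh)))) (at t within {0..}))"

end

theory Submission
  imports Defs
begin

text \<open>With \<open>\<epsilon>'\<close> continuous on \<open>[0, \<infinity>)\<close>, the Lyapunov--Krasovskii functional
  \<open>V = \<eta>\<^sup>T P \<eta> + \<integral> e\<^bsup>2\<alpha>(s-t)\<^esup> \<epsilon>\<^sup>T S \<epsilon> + h \<integral>\<integral> e\<^bsup>2\<alpha>(s-t)\<^esup> \<epsilon>'\<^sup>T R \<epsilon>'\<close>, where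
  \<open>\<eta> = (\<epsilon>(t), \<integral>\<^bsub>t-h\<^esub>\<^bsup>t\<^esup> \<epsilon>)\<close>, is classically differentiable for \<open>t > h\<close>. The first matrix
  inequality gives \<open>V \<ge> \<beta>\<^sub>1 |\<epsilon>(t)|\<^sup>2\<close> by weighted Cauchy--Schwarz inequalities. By the
  Wirtinger-based integral inequality, \<open>e\<^bsup>2\<alpha>t\<^esup> V\<close> has derivative at most
  \<open>e\<^bsup>2\<alpha>t\<^esup> \<xi>\<^sup>T \<Phi> \<xi>\<close> with \<open>\<xi> = (\<epsilon>(t), \<epsilon>(t-h), \<epsilon>'(t), (1/h) \<integral>\<^bsub>t-h\<^esub>\<^bsup>t\<^esup> \<epsilon>)\<close>, and the second
  matrix inequality makes this nonpositive because its slack terms cancel along solutions. On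
  \<open>[0, h]\<close>, where \<open>V\<close> would involve the possibly irregular derivative of the initial function, a
  crude growth bound suffices.\<close>

section \<open>Block vectors and the quadratic forms of the block matrices\<close>

text \<open>The sum index type matches \<open>hcat\<close> and \<open>vcat\<close>, so block
  matrices act on stacked vectors by rewriting alone.\<close>

definition vjoin :: "real^'a \<Rightarrow> real^'b \<Rightarrow> real^('a + 'b)" where
  "vjoin x y = (\<chi> i. case i of Inl k \<Rightarrow> x $ k | Inr k \<Rightarrow> y $ k)"

lemma sum_UNIV_Plus:
  "(\<Sum>i\<in>(UNIV :: ('a::finite + 'b::finite) set). f i) = (\<Sum>i\<in>UNIV. f (Inl i)) + (\<Sum>i\<in>UNIV. f (Inr i))"
  by (simp add: sum.Plus flip: UNIV_Plus_UNIV)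

lemma inner_vjoin [simp]:
  "vjoin x y \<bullet> vjoin x' y' = x \<bullet> x' + y \<bullet> y'"
  by (simp add: inner_vec_def sum_UNIV_Plus vjoin_def)

lemma vjoin_add: "vjoin x y + vjoin x' y' = vjoin (x + x') (y + y')"
  and vjoin_scaleR: "c *\<^sub>R vjoin x y = vjoin (c *\<^sub>R x) (c *\<^sub>R y)"
  by (auto simp: vec_eq_iff vjoin_def split: sum.split)

lemma hcat_vjoin [simp]: "hcat M N *v vjoin x y = M *v x + N *v y"
  by (simp add: vec_eq_iff matrix_vector_mult_def hcat_def vjoin_def sum_UNIV_Plus)

lemma vcat_mult_vector [simp]: "vcat M N *v x = vjoin (M *v x) (N *v x)"
  by (simp add: vec_eq_iff matrix_vector_mult_def vcat_def vjoin_def split: sum.split)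

lemma bdiag_vjoin [simp]: "bdiag M N *v vjoin x y = vjoin (M *v x) (N *v y)"
  by (simp add: bdiag_def block2_def)

lemma row4_vjoin [simp]:
  "row4 M1 M2 M3 M4 *v vjoin (vjoin a b) (vjoin c d) = M1 *v a + M2 *v b + M3 *v c + M4 *v d"
  by (simp add: row4_def)

lemma matrix_vector_mult_uminus [simp]: "(- M) *v x = - (M *v (x :: real^'n))"
  by (simp add: vec_eq_iff matrix_vector_mult_def sum_negf)

lemma scaleR_matrix_vector_mult [simp]: "(c *\<^sub>R M) *v x = c *\<^sub>R (M *v (x :: real^'n))"
  by (simp add: scaleR_matrix_vector_assoc)

text \<open>Moving the transposed left factor onto the vector lets a product such as
  \<open>transpose F2 ** R_tilde R ** F2\<close> be evaluated through \<open>F2 *v x\<close>,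
  without computing the matrix.\<close>

lemma inner_transpose_mult:
  fixes x :: "real^'k"
  shows "x \<bullet> ((transpose M ** Q) *v y) = (M *v x) \<bullet> (Q *v y)"
proof -
  have "x \<bullet> (transpose M *v z) = (M *v x) \<bullet> z" for z
    by (metis dot_lmul_matrix vector_transpose_matrix)
  then show ?thesis
    by (simp only: flip: matrix_vector_mul_assoc)
qed

lemma inner_transpose_mult3:
  fixes x :: "real^'k"
  shows "x \<bullet> ((transpose M ** Q ** T) *v y) = (M *v x) \<bullet> (Q *v (T *v y))"
  using inner_transpose_mult[of x M "Q ** T" y]
  by (simp only: matrix_vector_mul_assoc matrix_mul_assoc)

lemma inner_He: "x \<bullet> (He M *v x) = 2 * (x \<bullet> (M *v x))"
proof -
  have "x \<bullet> (transpose M *v x) = x \<bullet> (M *v x)"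
    by (metis dot_lmul_matrix inner_commute transpose_matrix_vector)
  then show ?thesis
    by (simp add: He_def matrix_vector_mult_add_rdistrib inner_add_right)
qed

text \<open>Along a solution the four blocks are \<epsilon>(t), \<epsilon>(t-h), \<epsilon>'(t) and
  the window mean. Then \<open>F1 h\<close> sends \<open>\<xi>\<close> to \<eta>, \<open>F0\<close>
  sends it to \<eta>', and \<open>F2\<close> produces the two vectors of the Wirtinger
  inequality.\<close>

lemma Phi_quadratic_form:
  fixes x y d m :: "real^'n"
  defines "\<xi> \<equiv> vjoin (vjoin x y) (vjoin d m)"
  shows "\<xi> \<bullet> (Phi P R S \<alpha> h *v \<xi>) =
    2 * (vjoin x (h *\<^sub>R m) \<bullet> (P *v (vjoin d (x - y) + \<alpha> *\<^sub>R vjoin x (h *\<^sub>R m))))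
    + x \<bullet> (S *v x) - exp (- 2 * \<alpha> * h) * (y \<bullet> (S *v y)) + h\<^sup>2 * (d \<bullet> (R *v d))
    - exp (- 2 * \<alpha> * h) * ((x - y) \<bullet> (R *v (x - y))
        + 3 * ((x + y - 2 *\<^sub>R m) \<bullet> (R *v (x + y - 2 *\<^sub>R m))))"
proof -
  have F0: "F0 *v \<xi> = vjoin d (x - y)" and F1: "F1 h *v \<xi> = vjoin x (h *\<^sub>R m)"
    and F2: "F2 *v \<xi> = vjoin (x - y) (x + y - 2 *\<^sub>R m)" and F3: "F3 *v \<xi> = d"
    by (simp_all add: F0_def F1_def F2_def F3_def \<xi>_def)
  have S: "\<xi> \<bullet> (S_bar S \<alpha> h *v \<xi>) = x \<bullet> (S *v x) - exp (- 2 * \<alpha> * h) * (y \<bullet> (S *v y))"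
    by (simp add: S_bar_def \<xi>_def)
  show ?thesis
    unfolding Phi_def
    by (simp only: matrix_vector_mult_add_rdistrib matrix_vector_mult_diff_rdistrib inner_add_right
        inner_diff_right inner_He inner_transpose_mult3 scaleR_matrix_vector_mult inner_scaleR_right
        F0 F1 F2 F3 S R_tilde_def bdiag_vjoin inner_vjoin)
qed

text \<open>The block matrix with factor \<open>k\<close> is the transposed row (h I, -I) times R
  times that row, hence a single square in \<open>h *\<^sub>R x - w\<close>, the vector that
  \<open>weighted_derivative_bound\<close> controls.\<close>

lemma lyapunov_matrix_quadratic_form:
  fixes x w :: "real^'n"
  defines "\<eta> \<equiv> vjoin x w"
  shows "\<eta> \<bullet> ((P + c *\<^sub>R bdiag 0 S + k *\<^sub>R block2 (h\<^sup>2 *\<^sub>R R) (- (h *\<^sub>R R)) (- (h *\<^sub>R R)) R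
           - \<beta> *\<^sub>R bdiag (mat 1) 0) *v \<eta>) =
    \<eta> \<bullet> (P *v \<eta>) + c * (w \<bullet> (S *v w)) + k * ((h *\<^sub>R x - w) \<bullet> (R *v (h *\<^sub>R x - w)))
     - \<beta> * (x \<bullet> x)"
proof -
  have "\<eta> \<bullet> (block2 (h\<^sup>2 *\<^sub>R R) (- (h *\<^sub>R R)) (- (h *\<^sub>R R)) R *v \<eta>)
      = (h *\<^sub>R x - w) \<bullet> (R *v (h *\<^sub>R x - w))"
    by (simp add: \<eta>_def block2_def matrix_vector_mult_diff_distrib matrix_vector_mult_scaleR
        inner_diff_left inner_diff_right inner_add_right inner_add_left
        algebra_simps power2_eq_square)
  moreover have "\<eta> \<bullet> (bdiag 0 S *v \<eta>) = w \<bullet> (S *v w)" "\<eta> \<bullet> (bdiag (mat 1) 0 *v \<eta>) = x \<bullet> x"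
    by (simp_all add: \<eta>_def)
  ultimately show ?thesis
    by (simp only: matrix_vector_mult_add_rdistrib matrix_vector_mult_diff_rdistrib inner_add_right
        inner_diff_right scaleR_matrix_vector_mult inner_scaleR_right)
qed

text \<open>Along the error system \<open>d = A x - L C m\<close>, and \<open>L\<^sup>T Z = Lbar\<^sup>T\<close> makes the two slack terms
  cancel.\<close>

lemma slack_terms_cancel:
  fixes A :: "real^'n^'n" and x y m :: "real^'n" and Lbar L :: "real^'p^'n" and C :: "real^'n^'p"
  assumes "invertible Z" and L: "L = transpose (matrix_inv Z) ** Lbar"
  defines "\<xi> \<equiv> vjoin (vjoin x y) (vjoin (A *v x - (L ** C) *v m) m)"
  shows "\<xi> \<bullet> (He (transpose (N_mat A) ** Z ** F
        + transpose (row4 0 0 0 (- (Lbar ** C))) ** F) *v \<xi>) = 0"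
proof -
  have "N_mat A *v \<xi> = (L ** C) *v m"
    by (simp add: N_mat_def \<xi>_def)
  also have "\<dots> = transpose (matrix_inv Z) *v ((Lbar ** C) *v m)"
    by (simp add: L matrix_vector_mul_assoc matrix_mul_assoc)
  finally have N: "N_mat A *v \<xi> = transpose (matrix_inv Z) *v ((Lbar ** C) *v m)" .
  have inv: "matrix_inv Z ** Z = mat 1"
    using assms(1) someI_ex[of "\<lambda>Y. Z ** Y = mat 1 \<and> Y ** Z = mat 1"]
    by (simp add: invertible_def matrix_inv_def)
  have "(N_mat A *v \<xi>) \<bullet> (Z *v (F *v \<xi>)) = ((Lbar ** C) *v m) \<bullet> ((matrix_inv Z ** Z) *v (F *v \<xi>))"
    unfolding N by (simp add: dot_lmul_matrix transpose_matrix_vector flip: matrix_vector_mul_assoc)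
  moreover have "row4 0 0 0 (- (Lbar ** C)) *v \<xi> = - ((Lbar ** C) *v m)"
    by (simp add: \<xi>_def)
  ultimately show ?thesis
    by (simp only: inner_He matrix_vector_mult_add_rdistrib inner_add_right inner_transpose_mult3
        inner_transpose_mult inner_minus_left inv matrix_vector_mul_lid) simp
qed

section \<open>Positive definite forms and weighted integral inequalities\<close>

lemma pos_def_nonneg: "pos_def M \<Longrightarrow> 0 \<le> x \<bullet> (M *v x)"
  by (cases "x = 0") (auto simp: pos_def_def intro: less_imp_le)

lemma symmetric_mat_inner:
  assumes "symmetric_mat M"
  shows "x \<bullet> (M *v y) = y \<bullet> (M *v x)"
  using assms unfolding symmetric_mat_def
  by (metis dot_lmul_matrix inner_commute transpose_matrix_vector)

lemma pos_def_symmetric: "pos_def M \<Longrightarrow> symmetric_mat M"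
  by (simp add: pos_def_def)

text \<open>Integrate \<open>\<omega> Q(g - r\<^sub>1 c\<^sub>1 - r\<^sub>2 c\<^sub>2) \<ge> 0\<close> with the optimal vectors \<open>c\<^sub>1, c\<^sub>2\<close>. Where a
  denominator vanishes, the corresponding term is \<open>x / 0 = 0\<close>.\<close>

lemma weighted_bessel_inequality:
  fixes g :: "real \<Rightarrow> real^'n" and R :: "real^'n^'n"
  assumes R: "pos_def R"
    and cont: "continuous_on {a..b} \<omega>" "continuous_on {a..b} r1" "continuous_on {a..b} r2"
      "continuous_on {a..b} g"
    and nonneg: "\<And>s. s \<in> {a..b} \<Longrightarrow> 0 \<le> \<omega> s"
    and d1: "((\<lambda>s. \<omega> s * (r1 s)\<^sup>2) has_integral d1) {a..b}"
    and d2: "((\<lambda>s. \<omega> s * (r2 s)\<^sup>2) has_integral d2) {a..b}"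
    and orth: "((\<lambda>s. \<omega> s * r1 s * r2 s) has_integral 0) {a..b}"
    and I1: "((\<lambda>s. (\<omega> s * r1 s) *\<^sub>R g s) has_integral I1) {a..b}"
    and I2: "((\<lambda>s. (\<omega> s * r2 s) *\<^sub>R g s) has_integral I2) {a..b}"
  shows "I1 \<bullet> (R *v I1) / d1 + I2 \<bullet> (R *v I2) / d2
    \<le> integral {a..b} (\<lambda>s. \<omega> s * (g s \<bullet> (R *v g s)))"
proof -
  define c1 where "c1 = (1 / d1) *\<^sub>R I1"
  define c2 where "c2 = (1 / d2) *\<^sub>R I2"
  define J where "J = integral {a..b} (\<lambda>s. \<omega> s * (g s \<bullet> (R *v g s)))"
  have J: "((\<lambda>s. \<omega> s * (g s \<bullet> (R *v g s))) has_integral J) {a..b}"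
    unfolding J_def
    by (intro integrable_integral integrable_continuous_real continuous_intros cont
        matrix_vector_mult_linear_continuous_on[THEN continuous_on_compose2[OF _ cont(4)]]) auto
  have lin: "bounded_linear (\<lambda>v. c \<bullet> (R *v v))" for c
    by (intro bounded_linear_intros matrix_vector_mul_bounded_linear)
  have L: "((\<lambda>s. (\<omega> s * r1 s) * (c1 \<bullet> (R *v g s))) has_integral c1 \<bullet> (R *v I1)) {a..b}"
       "((\<lambda>s. (\<omega> s * r2 s) * (c2 \<bullet> (R *v g s))) has_integral c2 \<bullet> (R *v I2)) {a..b}"
    using has_integral_linear[OF I1 lin[of c1]] has_integral_linear[OF I2 lin[of c2]]
    by (simp_all add: o_def matrix_vector_mult_scaleR)
  have total: "((\<lambda>s. \<omega> s * (g s \<bullet> (R *v g s))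
        - 2 * ((\<omega> s * r1 s) * (c1 \<bullet> (R *v g s))) - 2 * ((\<omega> s * r2 s) * (c2 \<bullet> (R *v g s)))
        + (c1 \<bullet> (R *v c1)) * (\<omega> s * (r1 s)\<^sup>2) + (c2 \<bullet> (R *v c2)) * (\<omega> s * (r2 s)\<^sup>2)
        + 2 * (c1 \<bullet> (R *v c2)) * (\<omega> s * r1 s * r2 s))
      has_integral (J - 2 * (c1 \<bullet> (R *v I1)) - 2 * (c2 \<bullet> (R *v I2)) + (c1 \<bullet> (R *v c1)) * d1
        + (c2 \<bullet> (R *v c2)) * d2 + 2 * (c1 \<bullet> (R *v c2)) * 0)) {a..b}"
    by (intro has_integral_add has_integral_diff has_integral_mult_right J L d1 d2 orth)
  have "0 \<le> J - 2 * (c1 \<bullet> (R *v I1)) - 2 * (c2 \<bullet> (R *v I2)) + (c1 \<bullet> (R *v c1)) * d1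
        + (c2 \<bullet> (R *v c2)) * d2 + 2 * (c1 \<bullet> (R *v c2)) * 0"
  proof (rule has_integral_nonneg[OF total])
    fix s assume s: "s \<in> {a..b}"
    define v where "v = g s - r1 s *\<^sub>R c1 - r2 s *\<^sub>R c2"
    have sym: "g s \<bullet> (R *v c1) = c1 \<bullet> (R *v g s)" "g s \<bullet> (R *v c2) = c2 \<bullet> (R *v g s)"
      "c2 \<bullet> (R *v c1) = c1 \<bullet> (R *v c2)"
      using symmetric_mat_inner[OF pos_def_symmetric[OF R]] by blast+
    have "0 \<le> \<omega> s * (v \<bullet> (R *v v))"
      using nonneg[OF s] pos_def_nonneg[OF R] by simp
    also have "\<dots> = \<omega> s * (g s \<bullet> (R *v g s))
        - 2 * ((\<omega> s * r1 s) * (c1 \<bullet> (R *v g s))) - 2 * ((\<omega> s * r2 s) * (c2 \<bullet> (R *v g s)))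
        + (c1 \<bullet> (R *v c1)) * (\<omega> s * (r1 s)\<^sup>2) + (c2 \<bullet> (R *v c2)) * (\<omega> s * (r2 s)\<^sup>2)
        + 2 * (c1 \<bullet> (R *v c2)) * (\<omega> s * r1 s * r2 s)"
      by (simp add: v_def matrix_vector_mult_diff_distrib matrix_vector_mult_scaleR inner_diff_left
          inner_diff_right sym power2_eq_square algebra_simps)
    finally show "0 \<le> \<dots>" .
  qed
  moreover have "c1 \<bullet> (R *v I1) = I1 \<bullet> (R *v I1) / d1" "(c1 \<bullet> (R *v c1)) * d1 = I1 \<bullet> (R *v I1) / d1"
    "c2 \<bullet> (R *v I2) = I2 \<bullet> (R *v I2) / d2" "(c2 \<bullet> (R *v c2)) * d2 = I2 \<bullet> (R *v I2) / d2"
    by (simp_all add: c1_def c2_def matrix_vector_mult_scaleR)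
  ultimately show ?thesis
    unfolding J_def by linarith
qed

text \<open>Bessel's inequality with \<open>r2 = 0\<close>: there \<open>d2\<close> and
  \<open>I2\<close> are 0, and the second quotient is 0 / 0 = 0.\<close>

lemma weighted_cauchy_schwarz:
  fixes g :: "real \<Rightarrow> real^'n" and R :: "real^'n^'n"
  assumes "pos_def R" "continuous_on {a..b} \<omega>" "continuous_on {a..b} r" "continuous_on {a..b} g"
    and "\<And>s. s \<in> {a..b} \<Longrightarrow> 0 \<le> \<omega> s"
    and "((\<lambda>s. \<omega> s * (r s)\<^sup>2) has_integral d) {a..b}"
    and "((\<lambda>s. (\<omega> s * r s) *\<^sub>R g s) has_integral I) {a..b}"
  shows "I \<bullet> (R *v I) / d \<le> integral {a..b} (\<lambda>s. \<omega> s * (g s \<bullet> (R *v g s)))"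
  using weighted_bessel_inequality[of R a b \<omega> r "\<lambda>_. 0" g d 0 I 0] assms by simp

text \<open>Cauchy-Schwarz is applied with constant weight 1; afterwards the exponential weight is
  bounded below by its value at the left end of the window, its minimum for \<alpha> \<ge>
  0.\<close>

lemma jensen_exp_weight:
  fixes x :: "real \<Rightarrow> real^'n"
  assumes S: "pos_def S" and h: "h > 0" and \<alpha>: "\<alpha> \<ge> 0" and x: "continuous_on {t - h..t} x"
  defines "w \<equiv> integral {t - h..t} x"
  shows "exp (- 2 * \<alpha> * h) / h * (w \<bullet> (S *v w))
    \<le> integral {t - h..t} (\<lambda>s. exp (2 * \<alpha> * (s - t)) * (x s \<bullet> (S *v x s)))"
proof -
  have "w \<bullet> (S *v w) / h \<le> integral {t - h..t} (\<lambda>s. 1 * (x s \<bullet> (S *v x s)))"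
    using has_integral_const_real[of "1::real" "t - h" t] h
    by (intro weighted_cauchy_schwarz[where r = "\<lambda>_. 1"] S x)
       (auto simp: w_def x intro!: integrable_integral integrable_continuous_real)
  then have "exp (- 2 * \<alpha> * h) * (w \<bullet> (S *v w) / h)
      \<le> exp (- 2 * \<alpha> * h) * integral {t - h..t} (\<lambda>s. x s \<bullet> (S *v x s))"
    by (intro mult_left_mono) simp_all
  also have "\<dots> = integral {t - h..t} (\<lambda>s. exp (- 2 * \<alpha> * h) * (x s \<bullet> (S *v x s)))"
    by simp
  also have "\<dots> \<le> integral {t - h..t} (\<lambda>s. exp (2 * \<alpha> * (s - t)) * (x s \<bullet> (S *v x s)))"
  proof (intro integral_le integrable_continuous_real continuous_intros x
        matrix_vector_mult_linear_continuous_on[THEN continuous_on_compose2[OF _ x]])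
    fix s assume "s \<in> {t - h..t}"
    then have "- (2 * \<alpha> * h) \<le> 2 * \<alpha> * (s - t)"
      using mult_left_mono[of "-h" "s - t" "2 * \<alpha>"] \<alpha> by auto
    then show "exp (- 2 * \<alpha> * h) * (x s \<bullet> (S *v x s)) \<le> exp (2 * \<alpha> * (s - t)) * (x s \<bullet> (S *v x s))"
      using pos_def_nonneg[OF S] by (intro mult_right_mono) auto
  qed auto
  finally show ?thesis by (simp add: mult_ac)
qed

text \<open>Bessel's inequality for the derivative, tested against 1 and the shifted Legendre
  polynomial \<open>p\<close> of degree one. Their squared norms on the window are h and h/3, which
  is where the factor 3 comes from.\<close>

lemma wirtinger_inequality:
  fixes x :: "real \<Rightarrow> real^'n"
  assumes R: "pos_def R" and h: "h > 0"
    and x: "\<And>s. s \<in> {t - h..t} \<Longrightarrow> (x has_vector_derivative d s) (at s within {t - h..t})"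
    and d: "continuous_on {t - h..t} d"
  defines "m \<equiv> (1 / h) *\<^sub>R integral {t - h..t} x"
  shows "(x t - x (t - h)) \<bullet> (R *v (x t - x (t - h)))
      + 3 * ((x t + x (t - h) - 2 *\<^sub>R m) \<bullet> (R *v (x t + x (t - h) - 2 *\<^sub>R m)))
    \<le> h * integral {t - h..t} (\<lambda>s. d s \<bullet> (R *v d s))"
proof -
  define p where "p = (\<lambda>s. 2 * (s - (t - h)) / h - 1)"
  have le: "t - h \<le> t" using h by simp
  have cx: "continuous_on {t - h..t} x"
    using x by (rule continuous_on_vector_derivative)
  \<comment> \<open>Integration by parts: \<open>p\<close> is -1 at t - h and 1 at t with slope 2/h,
    so testing the derivative against \<open>p\<close> yields x(t) + x(t-h) - 2m.\<close>
  have px: "((\<lambda>s. p s *\<^sub>R d s + (2 / h) *\<^sub>R x s) has_integral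
      (p t *\<^sub>R x t - p (t - h) *\<^sub>R x (t - h))) {t - h..t}"
    unfolding p_def using h
    by (intro fundamental_theorem_of_calculus[OF le])
       (auto intro!: derivative_eq_intros x simp: has_real_derivative_iff_has_vector_derivative[symmetric])
  have x2: "((\<lambda>s. (2 / h) *\<^sub>R x s) has_integral (2 / h) *\<^sub>R integral {t - h..t} x) {t - h..t}"
    by (intro has_integral_cmul integrable_integral integrable_continuous_real cx)
  have "((\<lambda>s. p s *\<^sub>R d s) has_integral (p t *\<^sub>R x t - p (t - h) *\<^sub>R x (t - h)
       - (2 / h) *\<^sub>R integral {t - h..t} x)) {t - h..t}"
    using has_integral_diff[OF px x2] by simp
  then have I2: "((\<lambda>s. (1 * p s) *\<^sub>R d s) has_integral (x t + x (t - h) - 2 *\<^sub>R m)) {t - h..t}"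
    using h by (simp add: p_def m_def)
  have I1: "((\<lambda>s. (1 * 1) *\<^sub>R d s) has_integral (x t - x (t - h))) {t - h..t}"
    using fundamental_theorem_of_calculus[OF le x] by simp
  \<comment> \<open>The increment of this antiderivative is h - t + (t - h) = 0, so \<open>p\<close>
    is orthogonal to 1.\<close>
  have p0: "((\<lambda>s. 1 * 1 * p s) has_integral
      ((t - (t - h))\<^sup>2 / h - t) - (((t - h) - (t - h))\<^sup>2 / h - (t - h))) {t - h..t}"
    unfolding p_def using h
    by (intro fundamental_theorem_of_calculus[OF le])
       (auto intro!: derivative_eq_intros simp: has_real_derivative_iff_has_vector_derivative[symmetric])
  have dp: "(p has_real_derivative 2 / h) (at s within T)" for s T
    unfolding p_def using h by (auto intro!: derivative_eq_intros)
  have "((\<lambda>s. (h / 6) * (p s)^3) has_real_derivative (p s)\<^sup>2) (at s within T)" for s T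
    using h by (auto intro!: derivative_eq_intros dp)
  then have p2: "((\<lambda>s. 1 * (p s)\<^sup>2) has_integral (h / 6) * (p t)^3 - (h / 6) * (p (t - h))^3) {t - h..t}"
    by (intro fundamental_theorem_of_calculus[OF le])
       (simp add: has_real_derivative_iff_has_vector_derivative[symmetric])
  have "(x t - x (t - h)) \<bullet> (R *v (x t - x (t - h))) / h
      + (x t + x (t - h) - 2 *\<^sub>R m) \<bullet> (R *v (x t + x (t - h) - 2 *\<^sub>R m)) / (h / 3)
    \<le> integral {t - h..t} (\<lambda>s. 1 * (d s \<bullet> (R *v d s)))"
  proof (rule weighted_bessel_inequality[where \<omega> = "\<lambda>_. 1" and ?r1.0 = "\<lambda>_. 1" and ?r2.0 = p,
        OF R _ _ _ d _ _ _ _ I1 I2])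
    show "((\<lambda>s. 1 * 1 * p s) has_integral 0) {t - h..t}"
      using p0 h by (simp add: power2_eq_square)
    show "((\<lambda>s. 1 * (p s)\<^sup>2) has_integral h / 3) {t - h..t}"
      using p2 h by (simp add: p_def)
    show "((\<lambda>s. 1 * 1\<^sup>2) has_integral h) {t - h..t}"
      using has_integral_const_real[of "1::real" "t - h" t] h by simp
    show "continuous_on {t - h..t} p"
      unfolding p_def using h by (intro continuous_intros) auto
  qed auto
  then show ?thesis
    using h by (simp add: field_simps)
qed

text \<open>The denominator of \<^const>\<open>R_coeff\<close> is \<open>\<integral> (s - (t - h)) e\<^bsup>2\<alpha>(t - s)\<^esup> ds\<close> up to the
  factor \<open>4\<alpha>\<^sup>2\<close>, and \<open>\<integral> (s - (t - h)) x'(s) ds = h x(t) - \<integral> x\<close>.\<close>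

lemma R_coeff_eq:
  assumes h: "h > 0"
  shows "\<exists>D. ((\<lambda>s. (s - (t - h)) * exp (2 * \<alpha> * (t - s))) has_integral D) {t - h..t}
      \<and> R_coeff \<alpha> h = h / D"
proof (cases "\<alpha> = 0")
  case True
  \<comment> \<open>Without the exponential the integral is h^2/2, and h / (h^2/2) is the limit
    value 2/h.\<close>
  have "((\<lambda>s. s - (t - h)) has_integral ((t - (t - h))\<^sup>2 / 2 - ((t - h) - (t - h))\<^sup>2 / 2)) {t - h..t}"
    using h by (intro fundamental_theorem_of_calculus)
      (auto intro!: derivative_eq_intros simp: has_real_derivative_iff_has_vector_derivative[symmetric])
  moreover have "R_coeff \<alpha> h = h / (h\<^sup>2 / 2)"
    using h True by (simp add: R_coeff_def power2_eq_square)
  ultimately show ?thesis using True by auto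
next
  case False
  define F where "F s = - ((s - (t - h)) / (2 * \<alpha>) + 1 / (4 * \<alpha>\<^sup>2)) * exp (2 * \<alpha> * (t - s))" for s
  have dF: "(F has_real_derivative (s - (t - h)) * exp (2 * \<alpha> * (t - s))) (at s within T)" for s T
    unfolding F_def using False
    by (auto intro!: derivative_eq_intros simp: field_simps power2_eq_square)
  have "((\<lambda>s. (s - (t - h)) * exp (2 * \<alpha> * (t - s))) has_integral (F t - F (t - h))) {t - h..t}"
    using h by (intro fundamental_theorem_of_calculus)
      (auto intro!: dF simp: has_real_derivative_iff_has_vector_derivative[symmetric])
  moreover have "F t - F (t - h) = (exp (2 * \<alpha> * h) - 2 * h * \<alpha> - 1) / (4 * \<alpha>\<^sup>2)"
    using False by (simp add: F_def field_simps power2_eq_square)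
  then have "R_coeff \<alpha> h = h / (F t - F (t - h))"
    using False by (simp add: R_coeff_def)
  ultimately show ?thesis by blast
qed

text \<open>Cauchy-Schwarz with weight \<omega> =
  \<open>(s - (t - h)) * exp (2 * \<alpha> * (s - t))\<close> and r =
  \<open>exp (2 * \<alpha> * (t - s))\<close>: then \<omega> r is the linear factor s - (t - h), and
  \<omega> r^2 has the integral \<open>D\<close> of \<open>R_coeff_eq\<close>.\<close>

lemma weighted_derivative_bound:
  fixes x :: "real \<Rightarrow> real^'n"
  assumes R: "pos_def R" and h: "h > 0"
    and x: "\<And>s. s \<in> {t - h..t} \<Longrightarrow> (x has_vector_derivative d s) (at s within {t - h..t})"
    and d: "continuous_on {t - h..t} d"
  defines "w \<equiv> integral {t - h..t} x"
  shows "R_coeff \<alpha> h * ((h *\<^sub>R x t - w) \<bullet> (R *v (h *\<^sub>R x t - w)))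
    \<le> h * integral {t - h..t} (\<lambda>s. (s - (t - h)) * exp (2 * \<alpha> * (s - t)) * (d s \<bullet> (R *v d s)))"
proof -
  have le: "t - h \<le> t" using h by simp
  have cx: "continuous_on {t - h..t} x"
    using x by (rule continuous_on_vector_derivative)
  obtain D where D: "R_coeff \<alpha> h = h / D"
    "((\<lambda>s. (s - (t - h)) * exp (2 * \<alpha> * (t - s))) has_integral D) {t - h..t}"
    using R_coeff_eq[OF h] by metis
  \<comment> \<open>Integration by parts; the boundary term at t - h vanishes.\<close>
  have px: "((\<lambda>s. (s - (t - h)) *\<^sub>R d s + x s) has_integral
      ((t - (t - h)) *\<^sub>R x t - ((t - h) - (t - h)) *\<^sub>R x (t - h))) {t - h..t}"
    by (intro fundamental_theorem_of_calculus[OF le])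
       (auto intro!: derivative_eq_intros x simp: has_real_derivative_iff_has_vector_derivative[symmetric])
  have x1: "(x has_integral w) {t - h..t}"
    unfolding w_def by (intro integrable_integral integrable_continuous_real cx)
  have I: "((\<lambda>s. (s - (t - h)) *\<^sub>R d s) has_integral (h *\<^sub>R x t - w)) {t - h..t}"
    using has_integral_diff[OF px x1] by simp
  have e: "exp (2 * \<alpha> * (s - t)) * exp (2 * \<alpha> * (t - s)) = 1" for s
    by (simp add: algebra_simps flip: exp_add)
  have e2: "u * exp (2 * \<alpha> * (s - t)) * (exp (2 * \<alpha> * (t - s)))\<^sup>2 = u * exp (2 * \<alpha> * (t - s))" for s u
    using e[of s] by (simp add: power2_eq_square)
  have e1: "u * exp (2 * \<alpha> * (s - t)) * exp (2 * \<alpha> * (t - s)) = u" for s u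
    using e[of s] by simp
  have "(h *\<^sub>R x t - w) \<bullet> (R *v (h *\<^sub>R x t - w)) / D
    \<le> integral {t - h..t} (\<lambda>s. (s - (t - h)) * exp (2 * \<alpha> * (s - t)) * (d s \<bullet> (R *v d s)))"
  proof (rule weighted_cauchy_schwarz[where r = "\<lambda>s. exp (2 * \<alpha> * (t - s))", OF R _ _ d])
    show "0 \<le> (s - (t - h)) * exp (2 * \<alpha> * (s - t))" if "s \<in> {t - h..t}" for s
      using that by simp
  qed (use D I in \<open>simp_all only: e1 e2\<close>, intro continuous_intros, intro continuous_intros)
  then have "h * ((h *\<^sub>R x t - w) \<bullet> (R *v (h *\<^sub>R x t - w)) / D)
    \<le> h * integral {t - h..t} (\<lambda>s. (s - (t - h)) * exp (2 * \<alpha> * (s - t)) * (d s \<bullet> (R *v d s)))"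
    using h by (intro mult_left_mono) auto
  then show ?thesis by (simp add: D(1))
qed

section \<open>Continuity and derivatives of integrals over a sliding window\<close>

lemma continuous_mult_matrix:
  assumes "continuous_on T f"
  shows "continuous_on T (\<lambda>t. (Q :: real^'k^'l) *v f t)"
  by (rule matrix_vector_mult_linear_continuous_on[THEN continuous_on_compose2[OF _ assms]]) auto

lemma integral_upto_continuous:
  fixes g :: "real \<Rightarrow> 'a::euclidean_space"
  assumes "continuous_on {a..} g"
  shows "continuous_on {a..} (\<lambda>t. integral {a..t} g)"
  unfolding continuous_on_eq_continuous_within
proof
  fix t assume "t \<in> {a..}"
  have "continuous_on {a..t+1} (\<lambda>t. integral {a..t} g)"
    by (intro indefinite_integral_continuous_1 integrable_continuous_real
        continuous_on_subset[OF assms]) auto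
  then have "continuous (at t within {a..t+1}) (\<lambda>t. integral {a..t} g)"
    using \<open>t \<in> {a..}\<close> by (simp add: continuous_on_eq_continuous_within)
  \<comment> \<open>Continuity at t is local, so the compact interval may replace the unbounded
    one.\<close>
  moreover have "at t within {a..} = at t within {a..t+1}"
    by (rule at_within_nhd[where S = "{..<t+1}"]) auto
  ultimately show "continuous (at t within {a..}) (\<lambda>t. integral {a..t} g)"
    by simp
qed

lemma integral_upto_derivative:
  fixes g :: "real \<Rightarrow> 'a::euclidean_space"
  assumes "continuous_on {a..} g" "t > a"
  shows "((\<lambda>t. integral {a..t} g) has_vector_derivative g t) (at t)"
proof -
  have "continuous_on {a..t+1} g"
    by (rule continuous_on_subset[OF assms(1)]) auto
  then have "((\<lambda>t. integral {a..t} g) has_vector_derivative g t) (at t within {a..t+1})"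
    using assms(2) by (intro integral_has_vector_derivative) auto
  moreover have "at t within {a..t+1} = at t"
    using assms(2) by (intro at_within_interior) (simp add: interior_atLeastAtMost_real)
  ultimately show ?thesis by simp
qed

text \<open>Both limits of the window move with t. Referring them to the fixed base point a leaves
  two indefinite integrals, to which the fundamental theorem applies.\<close>

lemma window_integral_eq:
  fixes g :: "real \<Rightarrow> 'a::euclidean_space"
  assumes "continuous_on {a..} g" "t \<ge> a + h" "h > 0"
  shows "integral {t - h..t} g = integral {a..t} g - integral {a..t - h} g"
proof -
  have "g integrable_on {a..t}"
    by (intro integrable_continuous_real continuous_on_subset[OF assms(1)]) auto
  then have "integral {a..t - h} g + integral {t - h..t} g = integral {a..t} g"
    using assms by (intro Henstock_Kurzweil_Integration.integral_combine) auto
  then show ?thesis by (simp add: algebra_simps)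
qed

lemma window_integral_continuous:
  fixes g :: "real \<Rightarrow> 'a::euclidean_space"
  assumes "continuous_on {a..} g" "h > 0"
  shows "continuous_on {a + h..} (\<lambda>t. integral {t - h..t} g)"
proof -
  have "continuous_on {a + h..} (\<lambda>t. integral {a..t} g - integral {a..t - h} g)"
    using assms(2)
    by (intro continuous_intros continuous_on_compose2[OF integral_upto_continuous[OF assms(1)]]) auto
  then show ?thesis
    by (rule continuous_on_eq) (use assms in \<open>simp add: window_integral_eq\<close>)
qed

lemma window_integral_derivative:
  fixes g :: "real \<Rightarrow> 'a::euclidean_space"
  assumes g: "continuous_on {a..} g" and h: "h > 0" and t: "t > a + h"
  shows "((\<lambda>t. integral {t - h..t} g) has_vector_derivative g t - g (t - h)) (at t)"
proof -
  have "((\<lambda>t. integral {a..t - h} g) has_vector_derivative g (t - h)) (at t)"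
  proof -
    have "((\<lambda>t. t - h) has_vector_derivative 1) (at t)"
      by (auto intro!: derivative_eq_intros)
    moreover have "((\<lambda>t. integral {a..t} g) has_vector_derivative g (t - h)) (at (t - h))"
      using integral_upto_derivative[OF g] t by simp
    ultimately show ?thesis
      using vector_diff_chain_at[of "\<lambda>t. t - h" 1 t "\<lambda>t. integral {a..t} g" "g (t - h)"]
      by (simp add: o_def)
  qed
  moreover have "((\<lambda>t. integral {a..t} g) has_vector_derivative g t) (at t)"
    using integral_upto_derivative[OF g] t h by simp
  ultimately have "((\<lambda>t. integral {a..t} g - integral {a..t - h} g)
      has_vector_derivative g t - g (t - h)) (at t)"
    by (rule has_vector_derivative_diff[rotated])
  then show ?thesis
    by (rule has_vector_derivative_transform_within_open[where S = "{a + h<..}"])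
       (use t g h in \<open>auto simp: window_integral_eq\<close>)
qed

text \<open>The weight depends on t; splitting it leaves window integrals whose integrands are free
  of t.\<close>

lemma window_moment_eq:
  fixes g :: "real \<Rightarrow> real"
  assumes "continuous_on {a..} g" "t \<ge> a + h"
  shows "integral {t - h..t} (\<lambda>s. (s - (t - h)) * g s)
    = integral {t - h..t} (\<lambda>s. s * g s) - (t - h) * integral {t - h..t} g"
proof -
  have g: "continuous_on {t - h..t} g"
    by (rule continuous_on_subset[OF assms(1)]) (use assms(2) in auto)
  have "integral {t - h..t} (\<lambda>s. s * g s - (t - h) * g s)
      = integral {t - h..t} (\<lambda>s. s * g s) - integral {t - h..t} (\<lambda>s. (t - h) * g s)"
    by (intro integral_diff integrable_continuous_real continuous_intros g)
  then show ?thesis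
    unfolding integral_mult_right left_diff_distrib[symmetric] .
qed

lemma window_moment_continuous:
  fixes g :: "real \<Rightarrow> real"
  assumes g: "continuous_on {a..} g" and h: "h > 0"
  shows "continuous_on {a + h..} (\<lambda>t. integral {t - h..t} (\<lambda>s. (s - (t - h)) * g s))"
proof -
  have "continuous_on {a + h..} (\<lambda>t. integral {t - h..t} (\<lambda>s. s * g s) - (t - h) * integral {t - h..t} g)"
    by (intro continuous_intros window_integral_continuous g h)
  then show ?thesis
    by (rule continuous_on_eq) (use g in \<open>simp add: window_moment_eq\<close>)
qed

text \<open>Leibniz's rule: the weight is h at s = t, vanishes at s = t - h, and decreases at unit
  rate in t.\<close>

lemma window_moment_derivative:
  fixes g :: "real \<Rightarrow> real"
  assumes g: "continuous_on {a..} g" and h: "h > 0" and t: "t > a + h"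
  shows "((\<lambda>t. integral {t - h..t} (\<lambda>s. (s - (t - h)) * g s))
    has_real_derivative h * g t - integral {t - h..t} g) (at t)"
proof -
  have sg: "continuous_on {a..} (\<lambda>s. s * g s)"
    by (intro continuous_intros g)
  have D: "((\<lambda>t. integral {t - h..t} g) has_real_derivative g t - g (t - h)) (at t)"
    "((\<lambda>t. integral {t - h..t} (\<lambda>s. s * g s)) has_real_derivative t * g t - (t - h) * g (t - h)) (at t)"
    using window_integral_derivative[OF g h t] window_integral_derivative[OF sg h t]
    by (simp_all add: has_real_derivative_iff_has_vector_derivative)
  have "((\<lambda>t. integral {t - h..t} (\<lambda>s. s * g s) - (t - h) * integral {t - h..t} g)
      has_real_derivative h * g t - integral {t - h..t} g) (at t)"
    by (rule derivative_eq_intros D refl)+ (simp add: algebra_simps)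
  then show ?thesis
    by (rule has_field_derivative_transform_within_open[where S = "{a + h<..}"])
       (use t in \<open>auto simp only: window_moment_eq[OF g] greaterThan_iff less_imp_le open_greaterThan\<close>)
qed

section \<open>Solutions of the delay equation and their growth on the first delay interval\<close>

text \<open>\<open>M\<close> stands for \<open>L ** C\<close>. The history enters through its
  continuity, so the bounds below use the size of \<open>e\<close> and never that of its derivative
  before time 0.\<close>

locale delay_trajectory =
  fixes A M :: "real^'n^'n" and h :: real and e :: "real \<Rightarrow> real^'n"
  assumes h_pos: "h > 0"
    and continuous_history: "continuous_on {-h..0} e"
    and ode: "t \<ge> 0 \<Longrightarrow> (e has_vector_derivative
        (A *v e t - (1 / h) *\<^sub>R (M *v integral {t - h..t} e))) (at t within {0..})"
begin

definition w :: "real \<Rightarrow> real^'n" where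
  "w t = integral {t - h..t} e"

text \<open>Taking the right-hand side of the equation as the derivative makes its continuity on
  \<open>{0..}\<close> evident.\<close>

definition d :: "real \<Rightarrow> real^'n" where
  "d t = A *v e t - (1 / h) *\<^sub>R (M *v w t)"

text \<open>Bounds \<open>d\<close> by the supremum of \<open>e\<close> on the window: the factor
  1/h cancels the window length in the bound on \<open>w\<close>. The added 1 makes the rate
  strictly positive.\<close>

definition growth_rate :: real where
  "growth_rate = onorm ((*v) A) + onorm ((*v) M) + 1"

lemma growth_rate_pos: "growth_rate > 0"
  using onorm_pos_le[OF matrix_vector_mul_bounded_linear[of A]]
    onorm_pos_le[OF matrix_vector_mul_bounded_linear[of M]]
  by (simp add: growth_rate_def)

lemma e_derivative: "t \<ge> 0 \<Longrightarrow> (e has_vector_derivative d t) (at t within {0..})"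
  using ode by (simp add: d_def w_def)

lemma e_derivative_at:
  assumes "t > 0"
  shows "(e has_vector_derivative d t) (at t)"
proof -
  have "at t within {0..} = at t"
    using assms by (intro at_within_interior) simp
  then show ?thesis
    using e_derivative[of t] assms by simp
qed

lemma continuous_e: "continuous_on {-h..} e"
proof -
  have "continuous_on {0..} e"
    by (rule continuous_on_vector_derivative) (use e_derivative in auto)
  then have "continuous_on ({-h..0} \<union> {0..}) e"
    by (intro continuous_on_closed_Un continuous_history) auto
  moreover have "{-h..0} \<union> {0..} = {-h..}"
    using h_pos by auto
  ultimately show ?thesis by simp
qed

lemma continuous_w: "continuous_on {0..} w"
  unfolding w_def using window_integral_continuous[OF continuous_e h_pos] by simp

lemma w_derivative: "t > 0 \<Longrightarrow> (w has_vector_derivative e t - e (t - h)) (at t)"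
  unfolding w_def using window_integral_derivative[OF continuous_e h_pos] by simp

lemma continuous_d: "continuous_on {0..} d"
  unfolding d_def
  by (intro continuous_intros continuous_mult_matrix continuous_w
      continuous_on_subset[OF continuous_e]) (use h_pos in auto)

lemma norm_w_le:
  assumes "\<And>s. s \<in> {t - h..t} \<Longrightarrow> norm (e s) \<le> K" "t \<ge> 0"
  shows "norm (w t) \<le> h * K"
proof -
  have "norm (integral {t - h..t} e) \<le> K * (t - (t - h))"
    using assms h_pos
    by (intro integral_bound continuous_on_subset[OF continuous_e]) auto
  then show ?thesis by (simp add: w_def mult.commute)
qed

lemma norm_d_le:
  assumes bound: "\<And>s. s \<in> {t - h..t} \<Longrightarrow> norm (e s) \<le> K" and t: "t \<ge> 0"
  shows "norm (d t) \<le> growth_rate * K"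
proof -
  have K: "0 \<le> K" "norm (e t) \<le> K"
    using bound[of t] order_trans[OF norm_ge_zero bound[of t]] h_pos by auto
  have "norm (A *v e t) \<le> onorm ((*v) A) * K"
    using onorm[OF matrix_vector_mul_bounded_linear, of A "e t"] K
      onorm_pos_le[OF matrix_vector_mul_bounded_linear[of A]]
    by (meson mult_left_mono order_trans)
  moreover have "norm (M *v w t) \<le> onorm ((*v) M) * (h * K)"
    using onorm[OF matrix_vector_mul_bounded_linear, of M "w t"] norm_w_le[OF bound t]
      onorm_pos_le[OF matrix_vector_mul_bounded_linear[of M]]
    by (meson mult_left_mono order_trans)
  then have "norm ((1 / h) *\<^sub>R (M *v w t)) \<le> onorm ((*v) M) * K"
    using h_pos by (simp add: field_simps)
  ultimately show ?thesis
    unfolding d_def growth_rate_def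
    using K norm_triangle_ineq4[of "A *v e t" "(1 / h) *\<^sub>R (M *v w t)"]
    by (simp only: distrib_right mult_1)
qed

text \<open>The maximum of \<open>e\<^bsup>-2ct\<^esup> |e(t)|\<close> over \<open>[0, h]\<close> absorbs itself in the mean value inequality.\<close>

lemma initial_growth:
  assumes hist: "\<And>s. s \<in> {-h..0} \<Longrightarrow> norm (e s) \<le> K" and t: "t \<in> {-h..h}"
  shows "norm (e t) \<le> 2 * (1 + growth_rate * h) * exp (2 * growth_rate * h) * K"
proof -
  define c where "c = growth_rate"
  have c: "c > 0" using growth_rate_pos by (simp add: c_def)
  have K: "0 \<le> K" using order_trans[OF norm_ge_zero hist[of 0]] h_pos by auto
  have "continuous_on {0..h} (\<lambda>s. exp (- 2 * c * s) * norm (e s))"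
    by (intro continuous_intros continuous_on_subset[OF continuous_e]) (use h_pos in auto)
  then obtain t0 where t0: "t0 \<in> {0..h}"
      "\<And>s. s \<in> {0..h} \<Longrightarrow> exp (- 2 * c * s) * norm (e s) \<le> exp (- 2 * c * t0) * norm (e t0)"
    using continuous_attains_sup[of "{0..h}"] h_pos by force
  define m where "m = exp (- 2 * c * t0) * norm (e t0)"
  have m0: "0 \<le> m" by (simp add: m_def)
  have m: "norm (e s) \<le> m * exp (2 * c * s)" if "s \<in> {0..h}" for s
    using t0(2)[OF that] unfolding m_def[symmetric]
    by (simp add: exp_minus field_simps)
  \<comment> \<open>The window may reach into the history, where \<open>K\<close> bounds
    \<open>e\<close>, and into [0, s], where the weighted maximum \<open>m\<close> does; the sum
    covers both.\<close>
  have d: "norm (d s) \<le> c * (K + m * exp (2 * c * s))" if s: "s \<in> {0..h}" for s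
    unfolding c_def
  proof (rule norm_d_le)
    fix r assume r: "r \<in> {s - h..s}"
    show "norm (e r) \<le> K + m * exp (2 * growth_rate * s)"
    proof (cases "r \<le> 0")
      case True
      then have "norm (e r) \<le> K" using r s by (intro hist) auto
      then show ?thesis using m0 by (simp add: add_increasing2)
    next
      case False
      then have "norm (e r) \<le> m * exp (2 * c * r)" using r s by (intro m) auto
      also have "\<dots> \<le> m * exp (2 * c * s)" using r c m0 by (intro mult_left_mono) auto
      finally show ?thesis using K by (simp add: c_def)
    qed
  qed (use s in auto)
  \<comment> \<open>The comparison function is an antiderivative of the bound on \<open>d\<close>;
    the exponent 2c, twice the growth rate, produces the factor 1/2.\<close>
  have "norm (e t0 - e 0) \<le> c * K * t0 + m * exp (2 * c * t0) / 2 - (c * K * 0 + m * exp (2 * c * 0) / 2)"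
  proof (cases "t0 = 0")
    case False
    show ?thesis
    proof (rule differentiable_bound_general[where \<phi> = "\<lambda>s. c * K * s + m * exp (2 * c * s) / 2"
            and f' = d and \<phi>' = "\<lambda>s. c * (K + m * exp (2 * c * s))"])
      show "0 < t0" using False t0 by auto
      show "continuous_on {0..t0} e"
        by (rule continuous_on_subset[OF continuous_e]) (use h_pos in auto)
      show "continuous_on {0..t0} (\<lambda>s. c * K * s + m * exp (2 * c * s) / 2)"
        by (intro continuous_intros) auto
      show "(e has_vector_derivative d s) (at s)" if "0 < s" "s < t0" for s
        using e_derivative_at that by simp
      show "((\<lambda>s. c * K * s + m * exp (2 * c * s) / 2) has_vector_derivative
          c * (K + m * exp (2 * c * s))) (at s)" for s
        unfolding has_real_derivative_iff_has_vector_derivative[symmetric]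
        by (auto intro!: derivative_eq_intros simp: algebra_simps)
      show "norm (d s) \<le> c * (K + m * exp (2 * c * s))" if "0 < s" "s < t0" for s
        using d that t0 by auto
    qed
  qed simp
  moreover have "norm (e 0) \<le> K" using hist[of 0] h_pos by simp
  moreover have "norm (e t0) \<le> norm (e 0) + norm (e t0 - e 0)"
    using norm_triangle_ineq[of "e 0" "e t0 - e 0"] by simp
  moreover have "c * K * t0 \<le> c * K * h" using t0 c K by (intro mult_left_mono) auto
  ultimately have "norm (e t0) \<le> K * (1 + c * h) + m * exp (2 * c * t0) / 2"
    using m0 by (simp add: algebra_simps)
  \<comment> \<open>Equality holds at the maximum point, so the half on the right is absorbed by the
    left side.\<close>
  moreover have "norm (e t0) = m * exp (2 * c * t0)"
    by (simp add: m_def exp_minus)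
  ultimately have "m * exp (2 * c * t0) \<le> 2 * K * (1 + c * h)" by simp
  moreover have "m * 1 \<le> m * exp (2 * c * t0)" using m0 c t0 by (intro mult_left_mono) auto
  ultimately have mK: "m \<le> 2 * K * (1 + c * h)" by simp
  have big: "1 \<le> exp (2 * c * h)" "0 \<le> c * h" using c h_pos by auto
  have "norm (e t) \<le> 2 * K * (1 + c * h) * exp (2 * c * h)"
  proof (cases "t \<le> 0")
    case True
    have "norm (e t) \<le> K * 1" using hist t True by simp
    also have "\<dots> \<le> K * (2 * (1 + c * h) * exp (2 * c * h))"
      using big K mult_mono[of 1 "2 * (1 + c * h)" 1 "exp (2 * c * h)"]
      by (intro mult_left_mono) auto
    finally show ?thesis by (simp add: mult_ac)
  next
    case False
    then have "norm (e t) \<le> m * exp (2 * c * t)" using t by (intro m) auto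
    also have "\<dots> \<le> 2 * K * (1 + c * h) * exp (2 * c * h)"
      using mK m0 c t K big by (intro mult_mono) auto
    finally show ?thesis .
  qed
  then show ?thesis by (simp add: c_def mult_ac)
qed

end

section \<open>The Lyapunov-Krasovskii functional along a trajectory\<close>

lemma inner_matrix_le:
  fixes Q :: "real^'n^'n"
  assumes "norm x \<le> K"
  shows "x \<bullet> (Q *v x) \<le> onorm ((*v) Q) * K\<^sup>2"
proof -
  have Q: "0 \<le> onorm ((*v) Q)"
    by (rule onorm_pos_le[OF matrix_vector_mul_bounded_linear])
  have "x \<bullet> (Q *v x) \<le> norm x * norm (Q *v x)"
    by (rule norm_cauchy_schwarz)
  also have "\<dots> \<le> norm x * (onorm ((*v) Q) * norm x)"
    by (intro mult_left_mono onorm matrix_vector_mul_bounded_linear) auto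
  also have "\<dots> = onorm ((*v) Q) * (norm x)\<^sup>2"
    by (simp add: power2_eq_square)
  also have "\<dots> \<le> onorm ((*v) Q) * K\<^sup>2"
    using assms Q by (intro mult_left_mono power_mono) auto
  finally show ?thesis .
qed

text \<open>Seen as a linear map on pairs, stacking inherits continuity and derivatives from the
  components.\<close>

lemma bounded_linear_vjoin: "bounded_linear (\<lambda>p. vjoin (fst p) (snd p))"
  unfolding linear_conv_bounded_linear[symmetric]
  by (rule linearI) (simp_all add: vjoin_add vjoin_scaleR)

lemma has_vector_derivative_vjoin:
  assumes "(x has_vector_derivative x') (at t within T)" "(y has_vector_derivative y') (at t within T)"
  shows "((\<lambda>t. vjoin (x t) (y t)) has_vector_derivative vjoin x' y') (at t within T)"
  using bounded_linear.has_vector_derivative[OF bounded_linear_vjoin has_vector_derivative_Pair[OF assms]]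
  by simp

lemma continuous_on_vjoin:
  assumes "continuous_on T x" "continuous_on T y"
  shows "continuous_on T (\<lambda>t. vjoin (x t) (y t))"
  using bounded_linear.continuous_on[OF bounded_linear_vjoin continuous_on_Pair[OF assms]]
  by simp

text \<open>The matrix inequalities enter already evaluated: \<open>coercive\<close> is the first
  one as a quadratic form, and \<open>decay\<close> is the second on vectors whose third block obeys
  the equation. There the slack terms vanish, so Z, the matrix \<open>Lbar\<close> and the four
  scalars have disappeared.\<close>

locale lyapunov_trajectory = delay_trajectory A M h e
  for A M :: "real^'n^'n" and h :: real and e :: "real \<Rightarrow> real^'n" +
  fixes P :: "real^('n + 'n)^('n + 'n)" and R S :: "real^'n^'n" and \<alpha> \<beta> :: real
  assumes alpha_nonneg: "\<alpha> \<ge> 0" and beta_pos: "\<beta> > 0"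
    and P: "symmetric_mat P" and R: "pos_def R" and S: "pos_def S"
    and coercive: "\<beta> * (x \<bullet> x) \<le> vjoin x v \<bullet> (P *v vjoin x v)
        + exp (- 2 * \<alpha> * h) / h * (v \<bullet> (S *v v))
        + R_coeff \<alpha> h * ((h *\<^sub>R x - v) \<bullet> (R *v (h *\<^sub>R x - v)))"
    and decay: "\<xi> = vjoin (vjoin x y) (vjoin (A *v x - M *v m) m) \<Longrightarrow> \<xi> \<bullet> (Phi P R S \<alpha> h *v \<xi>) \<le> 0"
begin

text \<open>After multiplication of V by \<open>exp (2 * \<alpha> * t)\<close> the weight no longer
  involves t, so the window lemmas apply to the densities.\<close>

definition s_density :: "real \<Rightarrow> real" where
  "s_density s = exp (2 * \<alpha> * s) * (e s \<bullet> (S *v e s))"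

definition r_density :: "real \<Rightarrow> real" where
  "r_density s = exp (2 * \<alpha> * s) * (d s \<bullet> (R *v d s))"

text \<open>This is \<open>e\<^bsup>2\<alpha>t\<^esup> V(t)\<close> for the Lyapunov--Krasovskii functional \<open>V\<close>; the double integral
  \<open>\<integral>\<^bsub>-h\<^esub>\<^bsup>0\<^esup> \<integral>\<^bsub>t+\<theta>\<^esub>\<^bsup>t\<^esup>\<close> of \<open>V\<close> is written as a single integral with weight \<open>s - (t - h)\<close>.\<close>

definition scaled_V :: "real \<Rightarrow> real" where
  "scaled_V t = exp (2 * \<alpha> * t) * (vjoin (e t) (w t) \<bullet> (P *v vjoin (e t) (w t)))
     + integral {t - h..t} s_density
     + h * integral {t - h..t} (\<lambda>s. (s - (t - h)) * r_density s)"

lemma continuous_e0: "continuous_on {0..} e"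
  by (rule continuous_on_subset[OF continuous_e]) (use h_pos in auto)

lemma continuous_s_density: "continuous_on {0..} s_density"
  unfolding s_density_def
  by (intro continuous_intros continuous_mult_matrix continuous_e0)

lemma continuous_r_density: "continuous_on {0..} r_density"
  unfolding r_density_def
  by (intro continuous_intros continuous_mult_matrix continuous_d)

lemma continuous_scaled_V: "continuous_on {h..} scaled_V"
proof -
  have sub: "{h..} \<subseteq> {0..}" using h_pos by auto
  have "continuous_on {h..} (\<lambda>t. vjoin (e t) (w t))"
    by (intro continuous_on_vjoin continuous_on_subset[OF continuous_e0 sub]
        continuous_on_subset[OF continuous_w sub])
  then show ?thesis
    unfolding scaled_V_def
    using window_integral_continuous[OF continuous_s_density h_pos]
      window_moment_continuous[OF continuous_r_density h_pos]
    by (intro continuous_intros continuous_mult_matrix) auto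
qed

text \<open>By \<open>jensen_exp_weight\<close> and \<open>weighted_derivative_bound\<close> the two
  integrals in V dominate the S and R terms of \<open>coercive\<close>. Windows with t \<ge> h stay
  in \<open>{0..}\<close>, where \<open>d\<close> is the derivative of \<open>e\<close>.\<close>

lemma scaled_V_ge:
  assumes t: "t \<ge> h"
  shows "exp (2 * \<alpha> * t) * (\<beta> * (norm (e t))\<^sup>2) \<le> scaled_V t"
proof -
  have sub: "{t - h..t} \<subseteq> {0..}" using t by auto
  have merge: "exp (2 * \<alpha> * t) * exp (2 * \<alpha> * (s - t)) = exp (2 * \<alpha> * s)" for s
    by (simp add: algebra_simps flip: exp_add)
  have "exp (2 * \<alpha> * t) * integral {t - h..t} (\<lambda>s. exp (2 * \<alpha> * (s - t)) * (e s \<bullet> (S *v e s)))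
      = integral {t - h..t} (\<lambda>s. exp (2 * \<alpha> * t) * (exp (2 * \<alpha> * (s - t)) * (e s \<bullet> (S *v e s))))"
    by (simp only: integral_mult_right)
  also have "\<dots> = integral {t - h..t} s_density"
    by (intro integral_cong) (simp only: s_density_def merge mult.assoc[symmetric])
  finally have sI: "integral {t - h..t} s_density
      = exp (2 * \<alpha> * t) * integral {t - h..t} (\<lambda>s. exp (2 * \<alpha> * (s - t)) * (e s \<bullet> (S *v e s)))" ..
  have "exp (2 * \<alpha> * t) * integral {t - h..t}
        (\<lambda>s. (s - (t - h)) * exp (2 * \<alpha> * (s - t)) * (d s \<bullet> (R *v d s)))
      = integral {t - h..t} (\<lambda>s. exp (2 * \<alpha> * t) *
        ((s - (t - h)) * exp (2 * \<alpha> * (s - t)) * (d s \<bullet> (R *v d s))))"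
    by (simp only: integral_mult_right)
  also have "\<dots> = integral {t - h..t} (\<lambda>s. (s - (t - h)) * r_density s)"
  proof (intro integral_cong)
    fix s
    have "exp (2 * \<alpha> * t) * ((s - (t - h)) * exp (2 * \<alpha> * (s - t)) * (d s \<bullet> (R *v d s)))
        = (s - (t - h)) * (exp (2 * \<alpha> * t) * exp (2 * \<alpha> * (s - t)) * (d s \<bullet> (R *v d s)))"
      by (simp only: mult_ac)
    then show "exp (2 * \<alpha> * t) * ((s - (t - h)) * exp (2 * \<alpha> * (s - t)) * (d s \<bullet> (R *v d s)))
        = (s - (t - h)) * r_density s"
      by (simp only: merge r_density_def)
  qed
  finally have rI: "integral {t - h..t} (\<lambda>s. (s - (t - h)) * r_density s)
      = exp (2 * \<alpha> * t) * integral {t - h..t}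
        (\<lambda>s. (s - (t - h)) * exp (2 * \<alpha> * (s - t)) * (d s \<bullet> (R *v d s)))" ..
  have "\<beta> * (e t \<bullet> e t) \<le> vjoin (e t) (w t) \<bullet> (P *v vjoin (e t) (w t))
      + exp (- 2 * \<alpha> * h) / h * (w t \<bullet> (S *v w t))
      + R_coeff \<alpha> h * ((h *\<^sub>R e t - w t) \<bullet> (R *v (h *\<^sub>R e t - w t)))"
    by (rule coercive)
  moreover have "exp (- 2 * \<alpha> * h) / h * (w t \<bullet> (S *v w t))
      \<le> integral {t - h..t} (\<lambda>s. exp (2 * \<alpha> * (s - t)) * (e s \<bullet> (S *v e s)))"
    unfolding w_def
    by (intro jensen_exp_weight[where x = e] S h_pos alpha_nonneg continuous_on_subset[OF continuous_e0 sub])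
  moreover have "R_coeff \<alpha> h * ((h *\<^sub>R e t - w t) \<bullet> (R *v (h *\<^sub>R e t - w t)))
      \<le> h * integral {t - h..t} (\<lambda>s. (s - (t - h)) * exp (2 * \<alpha> * (s - t)) * (d s \<bullet> (R *v d s)))"
    unfolding w_def
    by (intro weighted_derivative_bound[where x = e and d = d and t = t] R h_pos continuous_on_subset[OF continuous_d sub]
        has_vector_derivative_within_subset[OF e_derivative sub]) (use t in auto)
  ultimately have "exp (2 * \<alpha> * t) * (\<beta> * (e t \<bullet> e t)) \<le> exp (2 * \<alpha> * t) *
      (vjoin (e t) (w t) \<bullet> (P *v vjoin (e t) (w t))
       + integral {t - h..t} (\<lambda>s. exp (2 * \<alpha> * (s - t)) * (e s \<bullet> (S *v e s)))
       + h * integral {t - h..t} (\<lambda>s. (s - (t - h)) * exp (2 * \<alpha> * (s - t)) * (d s \<bullet> (R *v d s))))"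
    by (intro mult_left_mono) auto
  also have "\<dots> = scaled_V t"
    unfolding scaled_V_def sI rI by (simp only: distrib_left mult.left_commute[of h])
  finally show ?thesis by (simp add: power2_norm_eq_inner)
qed

text \<open>\<open>D\<close> agrees with
  \<open>E * (\<xi> \<bullet> (Phi P R S \<alpha> h *v \<xi>))\<close> term by term, except that it
  contains -h \<open>I\<close> where \<open>Phi\<close> has the Wirtinger term. The Wirtinger
  inequality compares these two, and \<open>decay\<close> gives the sign.\<close>

lemma scaled_V_derivative:
  assumes t: "t > h"
  obtains D where "(scaled_V has_real_derivative D) (at t)" "D \<le> 0"
proof -
  define \<eta> where "\<eta> = vjoin (e t) (w t)"
  define \<eta>' where "\<eta>' = vjoin (d t) (e t - e (t - h))"
  define m where "m = (1 / h) *\<^sub>R w t"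
  define E where "E = exp (2 * \<alpha> * t)"
  define I where "I = integral {t - h..t} r_density"
  define D where "D = (2 * \<alpha> * E) * (\<eta> \<bullet> (P *v \<eta>)) + E * (2 * (\<eta> \<bullet> (P *v \<eta>')))
      + (s_density t - s_density (t - h)) + h * (h * r_density t - I)"
  have t0: "t > 0" using t h_pos by simp
  have sub: "{t - h..t} \<subseteq> {0..}" using t by auto
  have dP: "((\<lambda>t. vjoin (e t) (w t) \<bullet> (P *v vjoin (e t) (w t))) has_real_derivative
      2 * (\<eta> \<bullet> (P *v \<eta>'))) (at t)"
  proof -
    have 1: "((\<lambda>t. vjoin (e t) (w t)) has_vector_derivative \<eta>') (at t)"
      unfolding \<eta>'_def by (intro has_vector_derivative_vjoin e_derivative_at w_derivative t0)
    have 2: "((\<lambda>t. P *v vjoin (e t) (w t)) has_vector_derivative P *v \<eta>') (at t)"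
      by (rule bounded_linear.has_vector_derivative[OF matrix_vector_mul_bounded_linear 1])
    have "((\<lambda>t. vjoin (e t) (w t) \<bullet> (P *v vjoin (e t) (w t))) has_vector_derivative
        (\<eta> \<bullet> (P *v \<eta>') + \<eta>' \<bullet> (P *v \<eta>))) (at t)"
      using bounded_bilinear.has_vector_derivative[OF bounded_bilinear_inner 1 2]
      by (simp add: \<eta>_def)
    moreover have "\<eta>' \<bullet> (P *v \<eta>) = \<eta> \<bullet> (P *v \<eta>')"
      by (rule symmetric_mat_inner[OF P])
    ultimately show ?thesis
      by (simp add: has_real_derivative_iff_has_vector_derivative)
  qed
  have dE: "((\<lambda>t. exp (2 * \<alpha> * t)) has_real_derivative 2 * \<alpha> * E) (at t)"
    unfolding E_def by (auto intro!: derivative_eq_intros)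
  have dS: "((\<lambda>t. integral {t - h..t} s_density) has_real_derivative s_density t - s_density (t - h)) (at t)"
    using window_integral_derivative[OF continuous_s_density h_pos] t
    by (simp add: has_real_derivative_iff_has_vector_derivative)
  have dR: "((\<lambda>t. integral {t - h..t} (\<lambda>s. (s - (t - h)) * r_density s))
      has_real_derivative h * r_density t - I) (at t)"
    unfolding I_def using window_moment_derivative[OF continuous_r_density h_pos] t by simp
  have "(scaled_V has_real_derivative D) (at t)"
    unfolding scaled_V_def D_def
    using DERIV_add[OF DERIV_add[OF DERIV_mult[OF dE dP] dS] DERIV_cmult[OF dR, of h]]
    unfolding E_def[symmetric] \<eta>_def[symmetric] by (simp only: mult.commute[of E])
  moreover have "D \<le> 0"
  proof -
    define \<xi> where "\<xi> = vjoin (vjoin (e t) (e (t - h))) (vjoin (A *v e t - M *v m) m)"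
    define B where "B = (e t - e (t - h)) \<bullet> (R *v (e t - e (t - h)))
      + 3 * ((e t + e (t - h) - 2 *\<^sub>R m) \<bullet> (R *v (e t + e (t - h) - 2 *\<^sub>R m)))"
    have "B \<le> h * integral {t - h..t} (\<lambda>s. d s \<bullet> (R *v d s))"
      unfolding B_def m_def w_def
      by (intro wirtinger_inequality[where x = e and d = d and t = t] R h_pos continuous_on_subset[OF continuous_d sub]
          has_vector_derivative_within_subset[OF e_derivative sub]) (use t in auto)
    then have "exp (2 * \<alpha> * (t - h)) * B
        \<le> h * (exp (2 * \<alpha> * (t - h)) * integral {t - h..t} (\<lambda>s. d s \<bullet> (R *v d s)))"
      unfolding mult.left_commute[of h] by (intro mult_left_mono) auto
    also have "exp (2 * \<alpha> * (t - h)) * integral {t - h..t} (\<lambda>s. d s \<bullet> (R *v d s))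
        = integral {t - h..t} (\<lambda>s. exp (2 * \<alpha> * (t - h)) * (d s \<bullet> (R *v d s)))"
      by (simp only: integral_mult_right)
    \<comment> \<open>On the window \<open>exp (2 * \<alpha> * s)\<close> is smallest at the left
      end, because \<alpha> \<ge> 0.\<close>
    also have "\<dots> \<le> I"
      unfolding I_def
    proof (intro integral_le integrable_continuous_real continuous_intros continuous_mult_matrix
          continuous_on_subset[OF continuous_d sub] continuous_on_subset[OF continuous_r_density sub])
      fix s assume "s \<in> {t - h..t}"
      then have "2 * \<alpha> * (t - h) \<le> 2 * \<alpha> * s"
        using alpha_nonneg by (intro mult_left_mono) auto
      then show "exp (2 * \<alpha> * (t - h)) * (d s \<bullet> (R *v d s)) \<le> r_density s"
        unfolding r_density_def using pos_def_nonneg[OF R] by (intro mult_right_mono) auto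
    qed
    finally have BI: "exp (2 * \<alpha> * (t - h)) * B \<le> h * I"
      using h_pos by simp
    have Eh: "exp (2 * \<alpha> * (t - h)) = E * exp (- 2 * \<alpha> * h)"
      by (simp add: E_def algebra_simps flip: exp_add)
    \<comment> \<open>These identities make \<open>F1 h *v \<xi>\<close> equal to
      \<open>\<eta>\<close> and \<open>F0 *v \<xi>\<close> equal to \<open>\<eta>'\<close>.\<close>
    have dm: "d t = A *v e t - M *v m" and hm: "h *\<^sub>R m = w t"
      using h_pos by (simp_all add: d_def m_def matrix_vector_mult_scaleR)
    have "D \<le> E * (\<xi> \<bullet> (Phi P R S \<alpha> h *v \<xi>))"
    proof -
      have "E * (\<xi> \<bullet> (Phi P R S \<alpha> h *v \<xi>)) =
        (2 * \<alpha> * E) * (\<eta> \<bullet> (P *v \<eta>)) + E * (2 * (\<eta> \<bullet> (P *v \<eta>')))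
        + (s_density t - s_density (t - h)) + h * (h * r_density t) - exp (2 * \<alpha> * (t - h)) * B"
        unfolding \<xi>_def Phi_quadratic_form hm dm[symmetric] \<eta>_def[symmetric] \<eta>'_def[symmetric]
          B_def[symmetric] s_density_def r_density_def Eh E_def[symmetric]
        unfolding matrix_vector_right_distrib matrix_vector_mult_scaleR inner_add_right
          inner_scaleR_right power2_eq_square
        by (simp only: distrib_left right_diff_distrib mult_ac)
      then show ?thesis
        using BI unfolding D_def by (simp add: right_diff_distrib)
    qed
    also have "\<dots> \<le> 0"
      using decay[OF \<xi>_def] by (simp add: E_def mult_nonneg_nonpos)
    finally show ?thesis .
  qed
  ultimately show thesis using that by blast
qed

text \<open>The comparison starts at h, the first time at which the whole window lies in
  \<open>{0..}\<close>; at h itself continuity replaces the derivative.\<close>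

lemma scaled_V_le_initial:
  assumes "t \<ge> h"
  shows "scaled_V t \<le> scaled_V h"
proof (rule DERIV_nonpos_imp_decreasing_open[where f = scaled_V])
  show "h \<le> t" by fact
  show "\<exists>y. (scaled_V has_real_derivative y) (at x) \<and> y \<le> 0" if "h < x" "x < t" for x
    using scaled_V_derivative[OF that(1)] by metis
  show "continuous_on {h..t} scaled_V"
    by (rule continuous_on_subset[OF continuous_scaled_V]) auto
qed

text \<open>If K bounds \<open>e\<close> on [-h, h], then (1 + h) K bounds the stacked vector at h
  and \<open>growth_rate * K\<close> bounds \<open>d\<close>. In h^3, one factor comes from the
  functional, one from the weight and one from the window length.\<close>

definition V_const :: real where
  "V_const = exp (2 * \<alpha> * h) * (onorm ((*v) P) * (1 + h)\<^sup>2 + h * onorm ((*v) S)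
     + h^3 * (onorm ((*v) R) * growth_rate\<^sup>2))"

lemma scaled_V_initial_le:
  assumes bound: "\<And>s. s \<in> {-h..h} \<Longrightarrow> norm (e s) \<le> K"
  shows "scaled_V h \<le> V_const * K\<^sup>2"
proof -
  define E where "E = exp (2 * \<alpha> * h)"
  have K: "0 \<le> K" using order_trans[OF norm_ge_zero bound[of 0]] h_pos by auto
  have E: "exp (2 * \<alpha> * s) \<le> E" if "s \<in> {0..h}" for s
    using that alpha_nonneg by (auto simp: E_def intro!: mult_left_mono)
  have w: "norm (w h) \<le> h * K"
    by (rule norm_w_le) (use bound h_pos in auto)
  have "(norm (vjoin (e h) (w h)))\<^sup>2 = (norm (e h))\<^sup>2 + (norm (w h))\<^sup>2"
    by (simp add: power2_norm_eq_inner)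
  also have "\<dots> \<le> K\<^sup>2 + (h * K)\<^sup>2"
    using w bound[of h] h_pos by (intro add_mono power_mono) auto
  also have "\<dots> \<le> ((1 + h) * K)\<^sup>2"
    using h_pos K by (simp add: power2_eq_square algebra_simps)
  finally have "norm (vjoin (e h) (w h)) \<le> (1 + h) * K"
    using h_pos K by (auto intro: power2_le_imp_le)
  then have 1: "vjoin (e h) (w h) \<bullet> (P *v vjoin (e h) (w h)) \<le> onorm ((*v) P) * ((1 + h) * K)\<^sup>2"
    by (rule inner_matrix_le)
  have 2: "integral {0..h} s_density \<le> h * (E * (onorm ((*v) S) * K\<^sup>2))"
  proof -
    have "integral {0..h} s_density \<le> integral {0..h} (\<lambda>_. E * (onorm ((*v) S) * K\<^sup>2))"
    proof (intro integral_le integrable_continuous_real continuous_intros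
          continuous_on_subset[OF continuous_s_density])
      fix s assume s: "s \<in> {0..h}"
      have "e s \<bullet> (S *v e s) \<le> onorm ((*v) S) * K\<^sup>2"
        by (rule inner_matrix_le) (use bound s h_pos in auto)
      then show "s_density s \<le> E * (onorm ((*v) S) * K\<^sup>2)"
        unfolding s_density_def using E[OF s] pos_def_nonneg[OF S]
        by (intro mult_mono) (auto simp: E_def)
    qed auto
    then show ?thesis using h_pos by (simp add: mult_ac)
  qed
  \<comment> \<open>At t = h the weight s - (t - h) is s.\<close>
  have 3: "integral {0..h} (\<lambda>s. s * r_density s) \<le> h * (h * (E * (onorm ((*v) R) * (growth_rate * K)\<^sup>2)))"
  proof -
    have "integral {0..h} (\<lambda>s. s * r_density s)
        \<le> integral {0..h} (\<lambda>_. h * (E * (onorm ((*v) R) * (growth_rate * K)\<^sup>2)))"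
    proof (intro integral_le integrable_continuous_real continuous_intros
          continuous_on_subset[OF continuous_r_density])
      fix s assume s: "s \<in> {0..h}"
      have "norm (d s) \<le> growth_rate * K"
        by (rule norm_d_le) (use bound s in auto)
      then have "d s \<bullet> (R *v d s) \<le> onorm ((*v) R) * (growth_rate * K)\<^sup>2"
        by (rule inner_matrix_le)
      then have "r_density s \<le> E * (onorm ((*v) R) * (growth_rate * K)\<^sup>2)"
        unfolding r_density_def using E[OF s] pos_def_nonneg[OF R]
        by (intro mult_mono) (auto simp: E_def)
      moreover have "0 \<le> r_density s"
        unfolding r_density_def using pos_def_nonneg[OF R] by simp
      ultimately show "s * r_density s \<le> h * (E * (onorm ((*v) R) * (growth_rate * K)\<^sup>2))"
        using s by (intro mult_mono) auto
    qed auto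
    then show ?thesis using h_pos by (simp add: mult_ac)
  qed
  have "scaled_V h \<le> E * (onorm ((*v) P) * ((1 + h) * K)\<^sup>2) + h * (E * (onorm ((*v) S) * K\<^sup>2))
      + h * (h * (h * (E * (onorm ((*v) R) * (growth_rate * K)\<^sup>2))))"
    unfolding scaled_V_def E_def[symmetric]
    using 1 2 3 h_pos by (intro add_mono mult_left_mono) (auto simp: E_def)
  also have "\<dots> = V_const * K\<^sup>2"
    unfolding V_const_def E_def[symmetric]
    unfolding power_mult_distrib power3_eq_cube by (simp only: distrib_left distrib_right[of _ _ "K\<^sup>2"] mult_ac)
  finally show ?thesis .
qed

definition initial_gain :: real where
  "initial_gain = 2 * (1 + growth_rate * h) * exp (2 * growth_rate * h)"

text \<open>The exponential serves times up to h and the square root later times, both after the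
  growth by \<open>initial_gain\<close>. The outer maximum ensures a gain of at least 1.\<close>

definition decay_gain :: real where
  "decay_gain = max 1 (max (exp (\<alpha> * h)) (sqrt (V_const / \<beta>)) * initial_gain)"

lemma exponential_bound:
  assumes hist: "\<And>s. s \<in> {-h..0} \<Longrightarrow> norm (e s) \<le> K" and t: "t > 0"
  shows "norm (e t) \<le> decay_gain * exp (- \<alpha> * t) * K"
proof -
  define K1 where "K1 = initial_gain * K"
  have K: "0 \<le> K" using order_trans[OF norm_ge_zero hist[of 0]] h_pos by auto
  have bound: "norm (e s) \<le> K1" if "s \<in> {-h..h}" for s
    using initial_growth[OF hist that] by (simp add: K1_def initial_gain_def)
  have K1: "0 \<le> K1" using order_trans[OF norm_ge_zero bound[of 0]] h_pos by auto
  have "exp (\<alpha> * t) * norm (e t) \<le> max (exp (\<alpha> * h)) (sqrt (V_const / \<beta>)) * K1"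
  proof (cases "t \<le> h")
    case True
    then have "exp (\<alpha> * t) * norm (e t) \<le> exp (\<alpha> * h) * K1"
      using t alpha_nonneg h_pos by (intro mult_mono bound) (auto intro: mult_left_mono)
    also have "\<dots> \<le> max (exp (\<alpha> * h)) (sqrt (V_const / \<beta>)) * K1"
      using K1 by (intro mult_right_mono) auto
    finally show ?thesis .
  next
    case False
    \<comment> \<open>Chains coercivity at t, monotonicity from h to t and the bound on the
      functional at h.\<close>
    then have "exp (2 * \<alpha> * t) * (\<beta> * (norm (e t))\<^sup>2) \<le> V_const * K1\<^sup>2"
      using scaled_V_ge[of t] scaled_V_le_initial[of t] scaled_V_initial_le[OF bound] by linarith
    moreover have "exp (2 * \<alpha> * t) = (exp (\<alpha> * t))\<^sup>2"
      by (simp add: power2_eq_square flip: exp_add)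
    ultimately have "(exp (\<alpha> * t) * norm (e t))\<^sup>2 \<le> V_const / \<beta> * K1\<^sup>2"
      using beta_pos by (simp add: power_mult_distrib field_simps)
    then have "exp (\<alpha> * t) * norm (e t) \<le> sqrt (V_const / \<beta> * K1\<^sup>2)"
      by (rule real_le_rsqrt)
    also have "\<dots> = sqrt (V_const / \<beta>) * K1"
      using K1 by (simp only: real_sqrt_mult real_sqrt_abs abs_of_nonneg)
    also have "\<dots> \<le> max (exp (\<alpha> * h)) (sqrt (V_const / \<beta>)) * K1"
      using K1 by (intro mult_right_mono) auto
    finally show ?thesis .
  qed
  also have "\<dots> \<le> decay_gain * K"
    unfolding K1_def decay_gain_def mult.assoc[symmetric] using K by (intro mult_right_mono) auto
  finally have "exp (\<alpha> * t) * norm (e t) \<le> decay_gain * K" .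
  then show ?thesis
    by (simp add: exp_minus field_simps)
qed

end

text \<open>\<open>norm_W\<close> may be infinite, whereas \<open>exponential_bound\<close> needs a
  real bound on the history. The attained maximum of the norm of \<open>e\<close> on [-h, 0] is one,
  and it lies below \<open>norm_W\<close>.\<close>

lemma (in lyapunov_trajectory) exp_estimate_decay_gain:
  assumes phi: "\<And>t. t \<in> {-h..0} \<Longrightarrow> e t = \<phi> t"
  shows "exp_estimate \<alpha> h decay_gain \<phi> e"
proof -
  have "continuous_on {-h..0} (\<lambda>s. norm (e s))"
    by (intro continuous_intros continuous_history)
  then obtain s0 where s0: "s0 \<in> {-h..0}" "\<And>s. s \<in> {-h..0} \<Longrightarrow> norm (e s) \<le> norm (e s0)"
    using continuous_attains_sup[of "{-h..0}"] h_pos by force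
  have "ereal (norm (\<phi> s0)) \<le> norm_h h \<phi>"
    unfolding norm_h_def using s0(1) by (rule SUP_upper)
  then have W: "ereal (norm (e s0)) \<le> norm_W h \<phi>"
    unfolding norm_W_def using phi[OF s0(1)] by (simp add: le_max_iff_disj)
  have gain: "0 \<le> decay_gain"
    unfolding decay_gain_def by simp
  show ?thesis
    unfolding exp_estimate_def
  proof (intro allI impI)
    fix t :: real assume "t > 0"
    then have "ereal (norm (e t)) \<le> ereal (decay_gain * exp (- \<alpha> * t)) * ereal (norm (e s0))"
      using exponential_bound[OF s0(2)] by simp
    also have "\<dots> \<le> ereal (decay_gain * exp (- \<alpha> * t)) * norm_W h \<phi>"
      using gain by (intro ereal_mult_left_mono W) simp
    finally show "ereal (norm (e t)) \<le> ereal (decay_gain * exp (- \<alpha> * t)) * norm_W h \<phi>" .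
  qed
qed

section \<open>From plant and observer to the error system, and the stability theorem\<close>

text \<open>Plant and observer histories are assumed integrable, not continuous, so the integral is
  split at 0.\<close>

lemma integrable_window:
  fixes x :: "real \<Rightarrow> 'a::euclidean_space"
  assumes "continuous_on {0..} x" "x integrable_on {-h..0}" "t \<ge> 0" "h \<ge> 0"
  shows "x integrable_on {t - h..t}"
proof -
  have "x integrable_on {0..t}"
    by (intro integrable_continuous_real continuous_on_subset[OF assms(1)]) auto
  then have "x integrable_on {-h..t}"
    using assms by (intro Henstock_Kurzweil_Integration.integrable_combine[of "-h" 0 t]) auto
  then show ?thesis
    by (rule integrable_on_subinterval) (use assms in auto)
qed

text \<open>The input terms cancel on subtraction; integrability of both states on the window merges
  their integrals into that of the error.\<close>

lemma observer_error_system: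
  assumes x: "plant A B u x" and ix: "x integrable_on {-h..0}"
    and y: "averaged_output C h x y"
    and xh: "observer A B C L h u y xh" and ixh: "xh integrable_on {-h..0}" and h: "h \<ge> 0"
  shows "error_system A C L h (\<lambda>t. x t - xh t)"
  unfolding error_system_def
proof (intro allI impI)
  fix t :: real assume t: "t \<ge> 0"
  have dx: "(x has_vector_derivative (A *v x t + B *v u t)) (at t within {0..})" if "t \<ge> 0" for t
    using x that by (simp add: plant_def)
  have dxh: "(xh has_vector_derivative (A *v xh t + B *v u t
         + L *v (y t - (1 / h) *\<^sub>R (C *v integral {t - h..t} xh)))) (at t within {0..})" if "t \<ge> 0" for t
    using xh that by (simp add: observer_def)
  have "continuous_on {0..} x" "continuous_on {0..} xh"
    using dx dxh by (auto intro!: continuous_on_vector_derivative)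
  then have "integral {t - h..t} (\<lambda>t. x t - xh t) = integral {t - h..t} x - integral {t - h..t} xh"
    using ix ixh t h by (intro integral_diff integrable_window) auto
  moreover have "y t = (1 / h) *\<^sub>R (C *v integral {t - h..t} x)"
    using y t by (simp add: averaged_output_def)
  ultimately have "(A *v x t + B *v u t) - (A *v xh t + B *v u t
         + L *v (y t - (1 / h) *\<^sub>R (C *v integral {t - h..t} xh)))
      = A *v (x t - xh t) - (1 / h) *\<^sub>R ((L ** C) *v integral {t - h..t} (\<lambda>t. x t - xh t))"
    by (simp add: matrix_vector_mult_diff_distrib matrix_vector_mult_scaleR scaleR_diff_right
        flip: matrix_vector_mul_assoc)
  then show "((\<lambda>t. x t - xh t) has_vector_derivative
      (A *v (x t - xh t) - (1 / h) *\<^sub>R ((L ** C) *v integral {t - h..t} (\<lambda>t. x t - xh t))))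
      (at t within {0..})"
    using has_vector_derivative_diff[OF dx[OF t] dxh[OF t]] by simp
qed

theorem theorem3:
  fixes A :: "real^'n^'n" and B :: "real^'m^'n" and C :: "real^'n^'p"
    and P :: "real^('n + 'n)^('n + 'n)" and R S Z :: "real^'n^'n"
    and Lbar L :: "real^'p^'n"
    and h \<alpha> \<epsilon>1 \<epsilon>2 \<epsilon>3 \<epsilon>4 \<beta>1 :: real
  assumes "h > 0" and "\<alpha> \<ge> 0"
    and "symmetric_mat P" and "pos_def R" and "pos_def S"
    and "invertible Z" and "\<beta>1 > 0"
    and "pos_def (P + (exp (- 2 * \<alpha> * h) / h) *\<^sub>R bdiag 0 S
           + R_coeff \<alpha> h *\<^sub>R block2 (h\<^sup>2 *\<^sub>R R) (- (h *\<^sub>R R)) (- (h *\<^sub>R R)) R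
           - \<beta>1 *\<^sub>R bdiag (mat 1) 0)"
    and "neg_def (Phi P R S \<alpha> h
           + He (transpose (N_mat A) ** Z ** F_eps \<epsilon>1 \<epsilon>2 \<epsilon>3 \<epsilon>4
                 + transpose (row4 0 0 0 (- (Lbar ** C))) ** F_eps \<epsilon>1 \<epsilon>2 \<epsilon>3 \<epsilon>4))"
    and "L = transpose (matrix_inv Z) ** Lbar"
  shows "alpha_stable \<alpha> h (error_system A C L h) \<and>
    (\<exists>\<gamma>\<ge>1. \<forall>(u :: real \<Rightarrow> real^'m) x y xh.
       plant A B u x \<longrightarrow> x integrable_on {-h..0} \<longrightarrow> averaged_output C h x y \<longrightarrow>
       observer A B C L h u y xh \<longrightarrow> xh integrable_on {-h..0} \<longrightarrow>
       (\<lambda>t. x t - xh t) differentiable_on {-h..0} \<longrightarrow>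
       exp_estimate \<alpha> h \<gamma> (\<lambda>t. x t - xh t) (\<lambda>t. x t - xh t))"
proof -
  note h = assms(1) and \<alpha> = assms(2) and P = assms(3) and R = assms(4) and S = assms(5)
    and Z = assms(6) and \<beta> = assms(7) and lower = assms(8) and upper = assms(9) and L = assms(10)
  \<comment> \<open>\<open>decay_gain\<close> is independent of the trajectory \<open>e\<close>, so
    one constant serves all solutions.\<close>
  define \<gamma> where "\<gamma> = lyapunov_trajectory.decay_gain A (L ** C) h P R S \<alpha> \<beta>1"
  have coercive: "\<beta>1 * (x \<bullet> x) \<le> vjoin x v \<bullet> (P *v vjoin x v)
      + exp (- 2 * \<alpha> * h) / h * (v \<bullet> (S *v v))
      + R_coeff \<alpha> h * ((h *\<^sub>R x - v) \<bullet> (R *v (h *\<^sub>R x - v)))" for x v :: "real^'n"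
    using pos_def_nonneg[OF lower, of "vjoin x v"] unfolding lyapunov_matrix_quadratic_form by simp
  have decay: "\<xi> \<bullet> (Phi P R S \<alpha> h *v \<xi>) \<le> 0"
    if \<xi>: "\<xi> = vjoin (vjoin x y) (vjoin (A *v x - (L ** C) *v m) m)" for \<xi> and x y m :: "real^'n"
  proof -
    \<comment> \<open>\<open>neg_def\<close> concerns nonzero vectors; at \<xi> = 0 the form is 0.
      The slack terms vanish on \<open>\<xi>\<close>, which leaves the form of
      \<open>Phi\<close>.\<close>
    have "\<xi> \<bullet> ((Phi P R S \<alpha> h + He (transpose (N_mat A) ** Z ** F_eps \<epsilon>1 \<epsilon>2 \<epsilon>3 \<epsilon>4
        + transpose (row4 0 0 0 (- (Lbar ** C))) ** F_eps \<epsilon>1 \<epsilon>2 \<epsilon>3 \<epsilon>4)) *v \<xi>) \<le> 0"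
      using upper by (cases "\<xi> = 0") (auto simp: neg_def_def intro: less_imp_le)
    then show ?thesis
      unfolding \<xi> matrix_vector_mult_add_rdistrib inner_add_right
      using slack_terms_cancel[OF Z L, where F = "F_eps \<epsilon>1 \<epsilon>2 \<epsilon>3 \<epsilon>4"
          and A = A and C = C and x = x and y = y and m = m]
      by (simp add: matrix_vector_mult_add_rdistrib inner_add_right)
  qed
  have trajectory: "lyapunov_trajectory A (L ** C) h e P R S \<alpha> \<beta>1"
    if "continuous_on {-h..0} e" "error_system A C L h e" for e
    using that h \<alpha> P R S \<beta> coercive decay
    by unfold_locales (auto simp: error_system_def)
  \<comment> \<open>The definition of \<open>decay_gain\<close> unfolds only for an actual trajectory; the zero one will do.\<close>
  have "error_system A C L h (\<lambda>_. 0)"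
    by (simp add: error_system_def)
  then interpret zero: lyapunov_trajectory A "L ** C" h "\<lambda>_. 0" P R S \<alpha> \<beta>1
    by (intro trajectory) auto
  have \<gamma>: "\<gamma> \<ge> 1"
    by (simp add: \<gamma>_def zero.decay_gain_def)
  have estimate: "exp_estimate \<alpha> h \<gamma> \<phi> e"
    if \<phi>: "\<phi> differentiable_on {-h..0}" and e\<phi>: "\<forall>t\<in>{-h..0}. e t = \<phi> t"
      and e: "error_system A C L h e" for \<phi> e
  proof -
    have "continuous_on {-h..0} \<phi>"
      by (rule differentiable_imp_continuous_on[OF \<phi>])
    then have "continuous_on {-h..0} e"
      by (rule continuous_on_eq) (use e\<phi> in simp)
    then interpret lyapunov_trajectory A "L ** C" h e P R S \<alpha> \<beta>1
      using e by (rule trajectory)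
    show ?thesis
      unfolding \<gamma>_def using e\<phi> by (intro exp_estimate_decay_gain) auto
  qed
  then have "alpha_stable \<alpha> h (error_system A C L h)"
    unfolding alpha_stable_def using \<gamma> by blast
  \<comment> \<open>The observer error serves as its own initial function, so the same
    \<open>\<gamma>\<close> applies.\<close>
  moreover have "exp_estimate \<alpha> h \<gamma> (\<lambda>t. x t - xh t) (\<lambda>t. x t - xh t)"
    if "plant A B u x" "x integrable_on {-h..0}" "averaged_output C h x y"
      "observer A B C L h u y xh" "xh integrable_on {-h..0}"
      "(\<lambda>t. x t - xh t) differentiable_on {-h..0}" for u :: "real \<Rightarrow> real^'m" and x y xh
    using that h by (intro estimate observer_error_system) auto
  ultimately show ?thesis
    using \<gamma> by blast
qed

end
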